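(* Let $\alpha>1$ and let $C=C_\alpha$ be such that $$e\,\overline K\sum_{t=1}^\infty\frac{(\log t)(\log(Ct^{1+\alpha}))}{t^{1+\alpha}}\le C.$$ Consider the M-LUCB algorithm (with $\epsilon=0$) using the exploration rate $\beta(t,\delta)=\log\left(Ct^{1+\alpha}/\delta\right)$. It is $\delta$-PAC, that is, for every $\delta\in(0,1)$ and every bandit instance $\bm\mu$ with $\mu_{1,1}>\mu_{2,1}$, $\mathbb P_{\bm\mu}(\mu_{1,1}-\mu_{\hat\imath,1}\le 0)\ge1-\delta$. Moreover, for every such $\bm\mu$, $$\limsup_{\delta\to0}\frac{\mathbb E_{\bm\mu}[\tau_\delta]}{\log(1/\delta)}\le 4H^*(\bm\mu),$$ where $$H^*(\bm\mu)=\sum_{(i,j)\in\mathcal P}\frac{1}{\max\left[\left(\mu_{i,1}-\frac{\mu_{1,1}+\mu_{2,1}}{2}\right)^2,\,(\mu_{i,j}-\mu_{i,1})^2\right]}.$$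
   Context: **Bandit model.** Let $K\ge 2$, $K_1,\dots,K_K\ge 1$ be integers, $\mathcal P=\{(i,j):1\le i\le K,\ 1\le j\le K_i\}$ and $\overline K=\sum_i K_i$. Each arm $P\in\mathcal P$ is a Bernoulli distribution with unknown mean $\mu_P\in[0,1]$; at each round $t=1,2,\dots$ one chooses an arm $P_t$ (depending on past observations) and observes $X_t$ drawn from the Bernoulli distribution with mean $\mu_{P_t}$ (successive draws of an arm are i.i.d., and arms are independent). $\mathbb P_{\bm\mu},\mathbb E_{\bm\mu}$ denote probability and expectation under $\bm\mu=(\mu_P)_{P\in\mathcal P}$. For the analysis (unknown to the algorithm), actions are labelled so that for each $i$, $j\mapsto\mu_{i,j}$ is nondecreasing, and $i\mapsto\mu_{i,1}$ is nonincreasing; thus the maximin action $i^*\in\operatorname{argmax}_i\min_j\mu_{i,j}$ is $1$. **Confidence bounds.** $N_P(t)=\sum_{s=1}^t\mathbf 1_{(P_s=P)}$, $\hat\mu_P(t)=\frac1{N_P(t)}\sum_{s=1}^tX_s\mathbf 1_{(P_s=P)}$, and $$L_P(t)=\hat\mu_P(t)-\sqrt{\tfrac{\beta(t,\delta)}{2N_P(t)}},\qquad U_P(t)=\hat\mu_P(t)+\sqrt{\tfrac{\beta(t,\delta)}{2N_P(t)}},$$ where $\beta(t,\delta)$ is the exploration rate; when $N_P(t)=0$, $L_P(t)=-\infty$ and $U_P(t)=+\infty$ (and $\hat\mu_P(t)$ is given an arbitrary value). **M-LUCB with $\epsilon=0$.** For every even $t\in\{0,2,4,\dots\}$ let $c_i(t)\in\operatorname{argmin}_{1\le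 j\le K_i}L_{(i,j)}(t)$, $\hat\imath(t)\in\operatorname{argmax}_i\min_j\hat\mu_{i,j}(t)$, and $$H_t=(\hat\imath(t),c_{\hat\imath(t)}(t)),\qquad S_t\in\operatorname{argmax}_{P\in\{(i,c_i(t)):\, i\ne\hat\imath(t)\}}U_P(t)$$ (ties broken arbitrarily). If not yet stopped, the algorithm draws $P_{t+1}=H_t$ and $P_{t+2}=S_t$. It stops at $$\tau_\delta=\inf\Big\{t\in2\mathbb N:\ \min_i\Big[\max_{i'\ne i}\min_{1\le j'\le K_{i'}}U_{(i',j')}(t)-\min_{1\le j\le K_i}L_{(i,j)}(t)\Big]<0\Big\}$$ and recommends $\hat\imath=\hat\imath(\tau_\delta)$.
   Formalization: It is additionally assumed that C>0 and that β(t,δ)≥0 for all even t>0 and δ in (0,1); the displayed inequality alone also admits tiny C, for which the square roots in the confidence bounds are undefined and the δ-PAC claim fails. *)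

theory Defs
  imports "HOL-Probability.Probability"
begin

type_synonym arm = "nat \<times> nat"
type_synonym history = "(arm \<times> bool) list"

text \<open>
  The number of actions is \<open>K\<close>, and \<open>Ks i\<close> is the number of arms of action \<open>i\<close>.
  Actions and arms are numbered from 1.
\<close>

definition arms :: "nat \<Rightarrow> (nat \<Rightarrow> nat) \<Rightarrow> arm set" where
  "arms K Ks = {(i, j). 1 \<le> i \<and> i \<le> K \<and> 1 \<le> j \<and> j \<le> Ks i}"

definition bandit_instance :: "nat \<Rightarrow> (nat \<Rightarrow> nat) \<Rightarrow> (arm \<Rightarrow> real) \<Rightarrow> bool" where
  "bandit_instance K Ks \<mu> \<longleftrightarrow>
     (\<forall>P\<in>arms K Ks. 0 \<le> \<mu> P \<and> \<mu> P \<le> 1) \<and>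
     (\<forall>i\<in>{1..K}. mono_on {1..Ks i} (\<lambda>j. \<mu> (i, j))) \<and>
     antimono_on {1..K} (\<lambda>i. \<mu> (i, 1))"

text \<open>
  A history lists the pairs (chosen arm, observed reward) in chronological order; the history
  after round \<open>t\<close> has length \<open>t\<close>.  The time \<open>t\<close> of the mathematical
  notation is thus the length of the history argument in the definitions below.
  The argument \<open>m0\<close> supplies the arbitrary value of the empirical mean of an arm
  that has not been drawn, and \<open>\<beta>\<close> is the exploration rate as a function of time.
\<close>

definition pulls :: "history \<Rightarrow> arm \<Rightarrow> nat" where
  "pulls h P = (\<Sum>s<length h. of_bool (fst (h ! s) = P))"

definition emp_mean :: "(history \<Rightarrow> arm \<Rightarrow> real) \<Rightarrow> history \<Rightarrow> arm \<Rightarrow> real" where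
  "emp_mean m0 h P =
     (if pulls h P = 0 then m0 h P
      else (\<Sum>s<length h. of_bool (snd (h ! s)) * of_bool (fst (h ! s) = P)) / real (pulls h P))"

definition lower_conf ::
    "(history \<Rightarrow> arm \<Rightarrow> real) \<Rightarrow> (nat \<Rightarrow> real) \<Rightarrow> history \<Rightarrow> arm \<Rightarrow> ereal" where
  "lower_conf m0 \<beta> h P =
     (if pulls h P = 0 then -\<infinity>
      else ereal (emp_mean m0 h P - sqrt (\<beta> (length h) / (2 * real (pulls h P)))))"

definition upper_conf ::
    "(history \<Rightarrow> arm \<Rightarrow> real) \<Rightarrow> (nat \<Rightarrow> real) \<Rightarrow> history \<Rightarrow> arm \<Rightarrow> ereal" where
  "upper_conf m0 \<beta> h P =
     (if pulls h P = 0 then \<infinity>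
      else ereal (emp_mean m0 h P + sqrt (\<beta> (length h) / (2 * real (pulls h P)))))"

definition expl_rate :: "real \<Rightarrow> real \<Rightarrow> real \<Rightarrow> nat \<Rightarrow> real" where
  "expl_rate C \<alpha> \<delta> t = ln (C * real t powr (1 + \<alpha>) / \<delta>)"

text \<open>
  The choices that the description of M-LUCB leaves open: the value of undefined empirical means
  and the way ties are broken.  The selections may depend on the past observations and, so as to
  allow randomised tie-breaking, on a seed of type \<open>'s\<close>: \<open>cand\<close> gives
  \<open>c\<^sub>i(t)\<close>, \<open>leader\<close> gives the empirical maximin action, and
  \<open>challenger\<close> gives \<open>S\<^sub>t\<close>.
\<close>

record 's mlucb_choice =
  init_mean :: "history \<Rightarrow> arm \<Rightarrow> real"
  cand :: "'s \<Rightarrow> history \<Rightarrow> nat \<Rightarrow> nat"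
  leader :: "'s \<Rightarrow> history \<Rightarrow> nat"
  challenger :: "'s \<Rightarrow> history \<Rightarrow> arm"

definition is_mlucb ::
    "nat \<Rightarrow> (nat \<Rightarrow> nat) \<Rightarrow> (nat \<Rightarrow> real) \<Rightarrow> 's measure \<Rightarrow> 's mlucb_choice \<Rightarrow> bool" where
  "is_mlucb K Ks \<beta> R A \<longleftrightarrow>
     (\<forall>h i. (\<lambda>u. cand A u h i) \<in> R \<rightarrow>\<^sub>M count_space UNIV) \<and>
     (\<forall>h. (\<lambda>u. leader A u h) \<in> R \<rightarrow>\<^sub>M count_space UNIV) \<and>
     (\<forall>h. (\<lambda>u. challenger A u h) \<in> R \<rightarrow>\<^sub>M count_space UNIV) \<and>
     (\<forall>u\<in>space R. \<forall>h. even (length h) \<longrightarrow>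
        (\<forall>i\<in>{1..K}.
           is_arg_min (\<lambda>j. lower_conf (init_mean A) \<beta> h (i, j)) (\<lambda>j. j \<in> {1..Ks i}) (cand A u h i)) \<and>
        is_arg_max (\<lambda>i. Min ((\<lambda>j. emp_mean (init_mean A) h (i, j)) ` {1..Ks i}))
          (\<lambda>i. i \<in> {1..K}) (leader A u h) \<and>
        is_arg_max (upper_conf (init_mean A) \<beta> h)
          (\<lambda>P. P \<in> {(i, cand A u h i) | i. i \<in> {1..K} \<and> i \<noteq> leader A u h}) (challenger A u h))"

text \<open>
  Rounds \<open>t + 1\<close> and \<open>t + 2\<close> (\<open>t\<close> even) both use the history of
  length \<open>t\<close>; hence the last observation is dropped in the second case.
\<close>

definition mlucb_policy :: "'s mlucb_choice \<Rightarrow> 's \<Rightarrow> history \<Rightarrow> arm" where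
  "mlucb_policy A u h =
     (if even (length h) then (leader A u h, cand A u h (leader A u h))
      else challenger A u (butlast h))"

text \<open>
  The entry \<open>Y (P, n)\<close> of a reward table is the outcome of draw number
  \<open>n + 1\<close> of arm \<open>P\<close>.  The process is continued for ever; stopping is
  expressed by \<open>stop_time\<close>.
\<close>

fun bandit_history :: "(history \<Rightarrow> arm) \<Rightarrow> (arm \<times> nat \<Rightarrow> bool) \<Rightarrow> nat \<Rightarrow> history" where
  "bandit_history \<pi> Y 0 = []"
| "bandit_history \<pi> Y (Suc t) =
     (let h = bandit_history \<pi> Y t; P = \<pi> h in h @ [(P, Y (P, pulls h P))])"

definition bandit_space ::
    "nat \<Rightarrow> (nat \<Rightarrow> nat) \<Rightarrow> 's measure \<Rightarrow> (arm \<Rightarrow> real) \<Rightarrow> ('s \<times> (arm \<times> nat \<Rightarrow> bool)) measure" where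
  "bandit_space K Ks R \<mu> =
     R \<Otimes>\<^sub>M (\<Pi>\<^sub>M (P, n) \<in> arms K Ks \<times> UNIV. measure_pmf (bernoulli_pmf (\<mu> P)))"

definition mlucb_history :: "'s mlucb_choice \<Rightarrow> 's \<times> (arm \<times> nat \<Rightarrow> bool) \<Rightarrow> nat \<Rightarrow> history" where
  "mlucb_history A \<omega> t = bandit_history (mlucb_policy A (fst \<omega>)) (snd \<omega>) t"

definition stop_condition ::
    "nat \<Rightarrow> (nat \<Rightarrow> nat) \<Rightarrow> (nat \<Rightarrow> real) \<Rightarrow> (history \<Rightarrow> arm \<Rightarrow> real) \<Rightarrow> history \<Rightarrow> bool" where
  "stop_condition K Ks \<beta> m0 h \<longleftrightarrow>
     Min ((\<lambda>i. Max ((\<lambda>i'. Min ((\<lambda>j'. upper_conf m0 \<beta> h (i', j')) ` {1..Ks i'})) ` ({1..K} - {i}))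
               - Min ((\<lambda>j. lower_conf m0 \<beta> h (i, j)) ` {1..Ks i})) ` {1..K}) < 0"

definition stop_time ::
    "nat \<Rightarrow> (nat \<Rightarrow> nat) \<Rightarrow> (nat \<Rightarrow> real) \<Rightarrow> 's mlucb_choice \<Rightarrow> 's \<times> (arm \<times> nat \<Rightarrow> bool) \<Rightarrow> enat" where
  "stop_time K Ks \<beta> A \<omega> =
     Inf {enat t | t. even t \<and> stop_condition K Ks \<beta> (init_mean A) (mlucb_history A \<omega> t)}"

text \<open>Only meaningful when \<open>stop_time\<close> is finite.\<close>

definition recommendation ::
    "nat \<Rightarrow> (nat \<Rightarrow> nat) \<Rightarrow> (nat \<Rightarrow> real) \<Rightarrow> 's mlucb_choice \<Rightarrow> 's \<times> (arm \<times> nat \<Rightarrow> bool) \<Rightarrow> nat" where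
  "recommendation K Ks \<beta> A \<omega> =
     leader A (fst \<omega>) (mlucb_history A \<omega> (the_enat (stop_time K Ks \<beta> A \<omega>)))"

definition H_star :: "nat \<Rightarrow> (nat \<Rightarrow> nat) \<Rightarrow> (arm \<Rightarrow> real) \<Rightarrow> real" where
  "H_star K Ks \<mu> =
     (\<Sum>(i, j)\<in>arms K Ks.
        1 / max ((\<mu> (i, 1) - (\<mu> (1, 1) + \<mu> (2, 1)) / 2)\<^sup>2) ((\<mu> (i, j) - \<mu> (i, 1))\<^sup>2))"

end

theory Submission
  imports Defs "HOL-Real_Asymp.Real_Asymp"
begin

text \<open>
  Stopping time.  If all confidence intervals are valid at an even time \<open>t\<close> and the algorithm has not
  stopped, then the interval of one of the two drawn arms contains the midpoint of \<open>\<mu>\<^sub>1\<^sub>,\<^sub>1\<close> and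
  \<open>\<mu>\<^sub>2\<^sub>,\<^sub>1\<close>.  Since that arm minimises the lower bound within its action, the width of its interval is
  at least the square root of the denominator \<open>D\<^sub>P\<close> of the corresponding term of \<open>H\<^sup>*\<close>, so it has been
  drawn at most \<open>2 \<beta>(t) / D\<^sub>P\<close> times.  Summing over the arms, \<open>\<tau> \<le> 4 H\<^sup>* \<beta>(\<tau>) + const + 2 Z\<close>, where
  \<open>Z\<close> counts the times with an invalid interval.  By Hoeffding's inequality and a union bound over the
  numbers of draws, \<open>Z\<close> has finite expectation because \<open>\<alpha> > 1\<close>.

  Correctness.  A wrong recommendation needs a one-sided deviation of one arm.  The two arms drawn
  from the same history are distinct, so an arm with \<open>n\<close> draws matters only from time \<open>2 n\<close> on, and a
  union bound over \<open>n\<close> gives the error probability \<open>\<delta> N \<zeta>(1 + \<alpha>) / D\<close>, with \<open>N\<close> the number of arms and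
  \<open>D = C 2\<^bsup>1 + \<alpha>\<^esup>\<close>.  This is at most \<open>\<delta>\<close> if \<open>D \<ge> e\<close>.  Otherwise the condition on \<open>C\<close> forces \<open>\<alpha>\<close> to be
  so large that no error is possible at the times \<open>4, 6, \<dots>, 30\<close>; a wrong stop at time 2 has
  probability at most 1/2 and is possible only if \<open>\<delta> > 5/9\<close>, and later errors have probability at most
  \<open>\<delta> / 10\<close>.
\<close>

subsection \<open>The constant in the exploration rate\<close>

text \<open>Telescoping: \<open>(k + 3/2) (k + 5/2)\<close> is 1/4 below \<open>(k + 2)^2\<close>,
  so every reciprocal square from the second on is at most a difference of consecutive values of
  \<open>1 / (k + 3/2)\<close>. The value 5/3 is also the lower bound for e ln 2 in
  \<open>rate_constant_cases\<close>.\<close>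

lemma sums_inverse_squares_le:
  "summable (\<lambda>k. 1 / (real (Suc k))\<^sup>2)" "(\<Sum>k. 1 / (real (Suc k))\<^sup>2) \<le> 5 / 3"
proof -
  let ?f = "\<lambda>k. 1 / (real k + 3 / 2)"
  have "?f \<longlonglongrightarrow> 0" by real_asymp
  then have f: "(\<lambda>k. ?f k - ?f (Suc k)) sums (2 / 3)"
    using telescope_sums'[of ?f 0] by simp
  have le: "1 / (real (Suc (Suc k)))\<^sup>2 \<le> ?f k - ?f (Suc k)" for k
  proof -
    have "?f k - ?f (Suc k) = 1 / ((real k + 3 / 2) * (real k + 5 / 2))"
      by (simp add: field_simps)
    moreover have "(real k + 3 / 2) * (real k + 5 / 2) \<le> (real (Suc (Suc k)))\<^sup>2"
      by (simp add: power2_eq_square algebra_simps)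
    ultimately show ?thesis by (simp add: frac_le)
  qed
  have s: "summable (\<lambda>k. 1 / (real (Suc (Suc k)))\<^sup>2)"
    by (rule summable_comparison_test'[OF sums_summable[OF f], of 0]) (use le in auto)
  then show s': "summable (\<lambda>k. 1 / (real (Suc k))\<^sup>2)"
    by (subst (asm) summable_Suc_iff[where f = "\<lambda>k. 1 / (real (Suc k))\<^sup>2"])
  have "(\<Sum>k. 1 / (real (Suc (Suc k)))\<^sup>2) \<le> 2 / 3"
    using suminf_le[OF le s sums_summable[OF f]] sums_unique[OF f] by simp
  then show "(\<Sum>k. 1 / (real (Suc k))\<^sup>2) \<le> 5 / 3"
    using suminf_split_head[OF s'] by simp
qed

lemma ln_exp_bounds: "exp 1 \<ge> (5 / 2 :: real)" "ln 3 \<ge> (1 :: real)" "ln (3 / 2) \<ge> (4 / 11 :: real)"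
proof -
  show "exp 1 \<ge> (5 / 2 :: real)" using exp_lower_Taylor_quadratic[of 1] by simp
  show ln3: "ln 3 \<ge> (1 :: real)" using exp_le by (subst ln_ge_iff) auto
  \<comment> \<open>The exponents come from 3^4 = 81, which is less than (3/2)^11, about
    86.5.\<close>
  have "4 * ln 3 = ln (3 ^ 4 :: real)" using ln_realpow[of "3 :: real" 4] by simp
  also have "\<dots> \<le> ln ((3 / 2) ^ 11)" by (subst ln_le_cancel_iff) (auto simp: field_simps)
  also have "\<dots> = 11 * ln (3 / 2 :: real)" by (subst ln_realpow) auto
  finally show "ln (3 / 2) \<ge> (4 / 11 :: real)" using ln3 by simp
qed

text \<open>\<open>suminf\<close> bounds partial sums only for a summable series. The terms are of
  order (ln n)^2 / n^s with s > 2, hence dominated by n^(-3/2).\<close>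

lemma summable_rate_series:
  fixes C s :: real
  assumes "C > 0" "s > 2"
  shows "summable (\<lambda>n. ln (real (Suc n)) * ln (C * real (Suc n) powr s) / real (Suc n) powr s)"
proof (rule summable_comparison_test_bigo)
  show "summable (\<lambda>n. norm (real n powr (-3/2)))"
    by (simp add: summable_real_powr_iff)
  show "(\<lambda>n. ln (real (Suc n)) * ln (C * real (Suc n) powr s) / real (Suc n) powr s)
    \<in> O(\<lambda>n. real n powr (-3/2))"
    using assms by real_asymp
qed

text \<open>The lower bound on \<open>C\<close> is used only through the terms \<open>t = 2\<close> and \<open>t = 3\<close> of its series.
  For \<open>D = C 2\<^sup>s\<close> they give \<open>D \<ge> e N (ln 2 ln D + ln 3 ln (3/2) s (2/3)\<^sup>s)\<close>.
  Either \<open>D \<ge> e\<close>, or \<open>D - e N ln 2 ln D \<le> 1\<close> and the second term forces \<open>s\<close> to be large.\<close>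
lemma rate_constant_cases:
  fixes C s N :: real
  assumes C: "C > 0" and s: "s > 2" and N: "N \<ge> 2" and D: "C * 2 powr s \<ge> 1"
    and series: "exp 1 * N *
      (\<Sum>n. ln (real (Suc n)) * ln (C * real (Suc n) powr s) / real (Suc n) powr s) \<le> C"
  shows "5 / 3 * N \<le> C * 2 powr s \<or> s \<ge> 4 \<and> N \<le> (3 / 2) powr s"
proof -
  define D where "D = C * 2 powr s"
  define f where "f n = ln (real (Suc n)) * ln (C * real (Suc n) powr s) / real (Suc n) powr s" for n
  have f_nonneg: "f n \<ge> 0" for n
  proof (cases n)
    case (Suc k)
    have "2 powr s \<le> real (Suc n) powr s" using s Suc by (intro powr_mono2) auto
    then have "C * 2 powr s \<le> C * real (Suc n) powr s" using C by simp
    then have "ln (C * real (Suc n) powr s) \<ge> 0" using D by simp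
    then show ?thesis by (simp add: f_def)
  qed (simp add: f_def)
  \<comment> \<open>Index \<open>n\<close> stands for time \<open>n + 1\<close>, so these are the
    terms of times 2 and 3.\<close>
  have "(\<Sum>n\<in>{1, 2}. f n) \<le> suminf f"
    using summable_rate_series[OF C s] f_nonneg by (intro sum_le_suminf) (auto simp: f_def)
  then have "f 1 + f 2 \<le> suminf f" by simp
  then have "exp 1 * N * (f 1 + f 2) \<le> exp 1 * N * suminf f"
    using N by (intro mult_left_mono) auto
  also have "\<dots> \<le> C" using series unfolding f_def[abs_def] .
  finally have "exp 1 * N * (f 1 + f 2) * 2 powr s \<le> D"
    unfolding D_def by (intro mult_right_mono) auto
  moreover have "f 1 * 2 powr s = ln 2 * ln D"
    by (simp add: f_def D_def)
  moreover have "f 2 * 2 powr s \<ge> ln 3 * (s * ln (3 / 2)) / (3 / 2) powr s"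
  proof -
    have "ln (C * 3 powr s) = ln D + s * ln (3 / 2)"
      using C by (simp add: D_def ln_mult ln_powr ln_div algebra_simps)
    moreover have "f 2 * 2 powr s = ln 3 * ln (C * 3 powr s) / (3 / 2) powr s"
      by (simp add: f_def powr_divide)
    moreover have "ln D \<ge> 0" using D by (simp add: D_def)
    ultimately show ?thesis by (simp add: divide_right_mono)
  qed
  ultimately have main: "exp 1 * N * (ln 2 * ln D) +
      exp 1 * N * (ln 3 * (s * ln (3 / 2)) / (3 / 2) powr s) \<le> D"
  proof -
    assume a: "exp 1 * N * (f 1 + f 2) * 2 powr s \<le> D" "f 1 * 2 powr s = ln 2 * ln D"
      "ln 3 * (s * ln (3 / 2)) / (3 / 2) powr s \<le> f 2 * 2 powr s"
    have "exp 1 * N * (ln 3 * (s * ln (3 / 2)) / (3 / 2) powr s) \<le> exp 1 * N * (f 2 * 2 powr s)"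
      using a(3) N by (intro mult_left_mono) auto
    with a(1,2) show ?thesis by (simp add: algebra_simps)
  qed
  have e: "exp 1 * ln 2 \<ge> (5 / 3 :: real)"
    using mult_mono[OF ln_exp_bounds(1) ln2_ge_two_thirds] by simp
  show ?thesis
  proof (cases "D \<ge> exp 1")
    case True
    then have "ln D \<ge> 1" by (subst ln_ge_iff) (auto intro: less_le_trans[OF exp_gt_zero])
    have "5 / 3 * N \<le> (exp 1 * ln 2) * N" using e N by (intro mult_right_mono) auto
    also have "\<dots> \<le> exp 1 * N * (ln 2 * ln D)"
      using \<open>ln D \<ge> 1\<close> N by (simp add: mult_left_mono mult_ac)
    also have "\<dots> \<le> D"
    proof -
      have "exp 1 * N * (ln 3 * (s * ln (3 / 2)) / (3 / 2) powr s) \<ge> 0" using N s by simp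
      with main show ?thesis by linarith
    qed
    finally show ?thesis by (simp add: D_def)
  next
    case False
    have D1: "D \<ge> 1" "D \<le> 3" using D False exp_le by (auto simp: D_def)
    have "ln (1 / D) \<le> 1 / D - 1" using D1 by (intro ln_le_minus_one) auto
    then have "1 - 1 / D \<le> ln D" using D1 by (simp add: ln_div)
    then have "(D - 1) / D \<le> ln D" using D1 by (simp add: diff_divide_distrib)
    \<comment> \<open>Here e N ln 2 \<ge> 10/3 \<ge> D, so e N ln 2 ln D \<ge> D (1 - 1/D) = D - 1.
      This leaves at most 1 for the second term of \<open>main\<close>.\<close>
    moreover have "D \<le> exp 1 * ln 2 * N"
      using mult_mono[OF e N] D1 by simp
    ultimately have "D * ((D - 1) / D) \<le> exp 1 * ln 2 * N * ln D"
      using D1 by (intro mult_mono) auto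
    then have "D - 1 \<le> exp 1 * N * (ln 2 * ln D)" using D1 by (simp add: mult_ac)
    with main have "exp 1 * N * (ln 3 * (s * ln (3 / 2)) / (3 / 2) powr s) \<le> 1" by linarith
    then have small: "exp 1 * N * (ln 3 * (s * ln (3 / 2))) \<le> (3 / 2) powr s"
      by (simp add: field_simps)
    have "10 / 11 * (N * s) \<le> exp 1 * N * (ln 3 * (s * ln (3 / 2)))"
    proof -
      have "(5 / 2) * (1 * (4 / 11)) \<le> exp 1 * (ln 3 * ln (3 / 2 :: real))"
        using ln_exp_bounds by (intro mult_mono) auto
      then have "(5 / 2) * (1 * (4 / 11)) * (N * s) \<le> exp 1 * (ln 3 * ln (3 / 2 :: real)) * (N * s)"
        using N s by (intro mult_right_mono) auto
      then show ?thesis by (simp add: mult_ac)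
    qed
    with small have Ns: "10 / 11 * (N * s) \<le> (3 / 2) powr s" by linarith
    have "2 * s \<le> N * s" using N s by (intro mult_right_mono) auto
    with Ns have s_le: "20 / 11 * s \<le> (3 / 2) powr s" by linarith
    have le_power: "(3 / 2 :: real) powr s \<le> (3 / 2) ^ k" if "s \<le> real k" for k
      using powr_mono[OF that, of "3 / 2"] by (simp add: powr_realpow)
    \<comment> \<open>Two rounds of improvement. If s < 3, the power is at most 27/8, but 20/11 s >
      40/11. If 3 \<le> s < 4, it is at most 81/16, but 20/11 s \<ge> 60/11.\<close>
    have "s \<ge> 3"
    proof (rule ccontr)
      assume "\<not> s \<ge> 3"
      with le_power[of 3] s_le s show False by (simp add: power3_eq_cube)
    qed
    then have "s \<ge> 4"
      using le_power[of 4] s_le by (cases "s \<ge> 4") (auto simp: power4_eq_xxxx)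
    have "N * 2 \<le> N * s" using N s by (intro mult_left_mono) auto
    with Ns N have "N \<le> (3 / 2) powr s" by linarith
    with \<open>s \<ge> 4\<close> show ?thesis by simp
  qed
qed

text \<open>The left-hand side is, up to the factor \<delta>, the union bound for errors from
  \<open>m = 16\<close> on. The quotient of N by 16^(s-2) is at most (9/4) (3/32)^(s-2), which is
  largest at s = 4.\<close>

lemma inverse_powr_tail_le:
  fixes s N :: real
  assumes s: "s \<ge> 4" and N: "0 \<le> N" "N \<le> (3 / 2) powr s"
  shows "N * (1 / 16 powr (s - 2)) * (5 / 3) \<le> 1 / 10"
proof -
  have "N / 16 powr (s - 2) \<le> (3 / 2) powr s / 16 powr (s - 2)"
    using N by (intro divide_right_mono) auto
  also have "(3 / 2) powr s = (9 / 4) * (3 / 2 :: real) powr (s - 2)"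
    by (simp add: powr_diff power2_eq_square powr_numeral)
  also have "(9 / 4) * (3 / 2) powr (s - 2) / 16 powr (s - 2) = (9 / 4) * (3 / 32 :: real) powr (s - 2)"
    using powr_divide[of "3 / 2" 16 "s - 2"] by simp
  also have "(3 / 32 :: real) powr (s - 2) \<le> (3 / 32) powr 2"
    using s by (intro powr_mono') auto
  finally have "N / 16 powr (s - 2) \<le> 81 / 4096" by (simp add: power2_eq_square)
  moreover have "N * (1 / 16 powr (s - 2)) * (5 / 3) = 5 / 3 * (N / 16 powr (s - 2))" by simp
  ultimately show ?thesis by linarith
qed

subsection \<open>Histories and reward tables\<close>

text \<open>The number of entries is fixed and the policy does not occur, so Hoeffding's inequality
  applies for each \<open>n\<close>, and a union bound over \<open>n\<close> takes care of the
  random number of draws.\<close>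

definition sample_mean :: "(arm \<times> nat \<Rightarrow> bool) \<Rightarrow> arm \<Rightarrow> nat \<Rightarrow> real" where
  "sample_mean Y P n = (\<Sum>k<n. of_bool (Y (P, k))) / real n"

lemma length_bandit_history [simp]: "length (bandit_history \<pi> Y t) = t"
  by (induction t) (simp_all add: Let_def)

lemma pulls_append: "pulls (h @ [(P, b)]) Q = pulls h Q + of_bool (P = Q)"
proof -
  have "(\<Sum>s<length h. of_bool (fst ((h @ [(P, b)]) ! s) = Q)) = pulls h Q"
    unfolding pulls_def by (intro sum.cong) (auto simp: nth_append)
  then show ?thesis by (simp add: pulls_def)
qed

lemma pulls_Nil [simp]: "pulls [] P = 0"
  by (simp add: pulls_def)

text \<open>The draw made after \<open>h\<close> reads entry number \<open>pulls h Q\<close> of the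
  row of \<open>Q\<close>, the first unread one. Hence the rewards seen from an arm form an initial
  segment of its row.\<close>

lemma bandit_history_rewards:
  "(\<Sum>s<length (bandit_history \<pi> Y t). of_bool (snd (bandit_history \<pi> Y t ! s)) *
       of_bool (fst (bandit_history \<pi> Y t ! s) = P))
     = (\<Sum>k<pulls (bandit_history \<pi> Y t) P. of_bool (Y (P, k)) :: real)"
proof (induction t)
  case 0
  then show ?case by simp
next
  case (Suc t)
  define h where "h = bandit_history \<pi> Y t"
  define Q where "Q = \<pi> h"
  define h' where "h' = h @ [(Q, Y (Q, pulls h Q))]"
  have h': "bandit_history \<pi> Y (Suc t) = h'"
    by (simp add: h'_def h_def Q_def Let_def)
  have "(\<Sum>s<length h. of_bool (snd (h' ! s)) * of_bool (fst (h' ! s) = P))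
      = (\<Sum>s<length h. of_bool (snd (h ! s)) * of_bool (fst (h ! s) = P) :: real)"
    by (intro sum.cong) (auto simp: nth_append h'_def)
  then have "(\<Sum>s<length h'. of_bool (snd (h' ! s)) * of_bool (fst (h' ! s) = P))
      = (\<Sum>k<pulls h P. of_bool (Y (P, k))) + (of_bool (Y (Q, pulls h Q)) * of_bool (Q = P) :: real)"
    using Suc.IH unfolding h_def[symmetric] by (simp add: h'_def)
  also have "\<dots> = (\<Sum>k<pulls h' P. of_bool (Y (P, k)))"
    by (cases "Q = P") (simp_all add: h'_def pulls_append del: sum_of_bool_eq)
  finally show ?case unfolding h' .
qed

lemma emp_mean_bandit_history:
  assumes "pulls (bandit_history \<pi> Y t) P > 0"
  shows "emp_mean m0 (bandit_history \<pi> Y t) P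
    = sample_mean Y P (pulls (bandit_history \<pi> Y t) P)"
  using assms unfolding emp_mean_def bandit_history_rewards sample_mean_def by simp

lemma pulls_bandit_history_Suc:
  "pulls (bandit_history \<pi> Y (Suc t)) P =
     pulls (bandit_history \<pi> Y t) P + of_bool (\<pi> (bandit_history \<pi> Y t) = P)"
  by (simp add: Let_def pulls_append)

lemma pulls_bandit_history_mono:
  "s \<le> t \<Longrightarrow> pulls (bandit_history \<pi> Y s) P \<le> pulls (bandit_history \<pi> Y t) P"
  by (induction t rule: dec_induct) (auto simp del: bandit_history.simps simp: pulls_bandit_history_Suc)

lemma sample_mean_bounds: "0 \<le> sample_mean Y P n" "sample_mean Y P n \<le> 1"
proof -
  show "0 \<le> sample_mean Y P n"
    by (auto simp: sample_mean_def intro!: divide_nonneg_nonneg sum_nonneg)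
  have "(\<Sum>k<n. of_bool (Y (P, k)) :: real) \<le> (\<Sum>k<n. 1)"
    by (intro sum_mono) auto
  then show "sample_mean Y P n \<le> 1"
    by (auto simp: sample_mean_def divide_le_eq_1)
qed

lemma mlucb_policy_even:
  assumes "t = 2 * m" "h = bandit_history (mlucb_policy A u) Y t"
  shows "mlucb_policy A u h = (leader A u h, cand A u h (leader A u h))"
    and "mlucb_policy A u (bandit_history (mlucb_policy A u) Y (Suc t)) = challenger A u h"
  using assms by (simp_all add: mlucb_policy_def Let_def)

text \<open>Both arms of a pair are determined by the history of length \<open>2 * m\<close>,
  because the policy drops the last observation at odd lengths.\<close>

lemma pulls_two_rounds:
  fixes A :: "'s mlucb_choice" and u Y m
  defines "h \<equiv> bandit_history (mlucb_policy A u) Y"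
  shows "pulls (h (2 * Suc m)) P = pulls (h (2 * m)) P
    + of_bool ((leader A u (h (2 * m)), cand A u (h (2 * m)) (leader A u (h (2 * m)))) = P)
    + of_bool (challenger A u (h (2 * m)) = P)"
proof -
  have e: "2 * Suc m = Suc (Suc (2 * m))" by simp
  have "mlucb_policy A u (h (2 * m)) =
      (leader A u (h (2 * m)), cand A u (h (2 * m)) (leader A u (h (2 * m))))"
    unfolding h_def by (rule mlucb_policy_even(1)[OF refl refl])
  moreover have "mlucb_policy A u (h (Suc (2 * m))) = challenger A u (h (2 * m))"
    unfolding h_def by (rule mlucb_policy_even(2)[OF refl refl])
  ultimately show ?thesis
    unfolding e h_def by (simp add: pulls_bandit_history_Suc del: bandit_history.simps)
qed

subsection \<open>One decision of the algorithm\<close>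

lemma finite_arms [simp]: "finite (arms K Ks)"
proof -
  have "arms K Ks = Sigma {1..K} (\<lambda>i. {1..Ks i})" by (auto simp: arms_def)
  then show ?thesis by simp
qed

lemma card_arms: "card (arms K Ks) = (\<Sum>i=1..K. Ks i)"
proof -
  have "arms K Ks = Sigma {1..K} (\<lambda>i. {1..Ks i})" by (auto simp: arms_def)
  then show ?thesis by simp
qed

definition midpoint :: "(arm \<Rightarrow> real) \<Rightarrow> real" where
  "midpoint \<mu> = (\<mu> (1, 1) + \<mu> (2, 1)) / 2"

text \<open>The denominator of the term of \<open>P\<close> in \<open>H_star\<close>; see
  \<open>H_star_eq\<close>.\<close>

definition gap_sq :: "(arm \<Rightarrow> real) \<Rightarrow> arm \<Rightarrow> real" where
  "gap_sq \<mu> P = max ((\<mu> (fst P, 1) - midpoint \<mu>)\<^sup>2) ((\<mu> P - \<mu> (fst P, 1))\<^sup>2)"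

text \<open>One decision at an even time, with the history and the selections as plain data, so that
  the argument about confidence intervals is purely deterministic. The sign condition on the rate
  puts the empirical mean between the two bounds.\<close>

locale mlucb_decision =
  fixes K :: nat and Ks :: "nat \<Rightarrow> nat" and \<mu> :: "arm \<Rightarrow> real"
    and \<beta> :: "nat \<Rightarrow> real" and m0 :: "history \<Rightarrow> arm \<Rightarrow> real" and h :: history
    and lead :: nat and c :: "nat \<Rightarrow> nat" and S :: arm
  assumes K: "K \<ge> 2" and Ks: "i \<in> {1..K} \<Longrightarrow> Ks i \<ge> 1"
    and inst: "bandit_instance K Ks \<mu>" and gap: "\<mu> (1, 1) > \<mu> (2, 1)"
    and rate: "\<beta> (length h) \<ge> 0"
    and c: "i \<in> {1..K} \<Longrightarrow>
      is_arg_min (\<lambda>j. lower_conf m0 \<beta> h (i, j)) (\<lambda>j. j \<in> {1..Ks i}) (c i)"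
    and lead: "is_arg_max (\<lambda>i. Min ((\<lambda>j. emp_mean m0 h (i, j)) ` {1..Ks i})) (\<lambda>i. i \<in> {1..K}) lead"
    and S: "is_arg_max (upper_conf m0 \<beta> h) (\<lambda>P. P \<in> {(i, c i) | i. i \<in> {1..K} \<and> i \<noteq> lead}) S"
begin

abbreviation "L \<equiv> lower_conf m0 \<beta> h"
abbreviation "U \<equiv> upper_conf m0 \<beta> h"

definition valid :: "arm \<Rightarrow> bool" where
  "valid P \<longleftrightarrow> L P \<le> ereal (\<mu> P) \<and> ereal (\<mu> P) \<le> U P"

abbreviation "mid \<equiv> midpoint \<mu>"

section \<open>Elementary properties of the bounds and of the selections\<close>

lemma L_not_PInf [simp]: "L P \<noteq> \<infinity>"
  by (auto simp: lower_conf_def)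

lemma L_le_emp: "L P \<le> ereal (emp_mean m0 h P)"
  using rate by (auto simp: lower_conf_def)

lemma emp_le_U: "ereal (emp_mean m0 h P) \<le> U P"
  using rate by (auto simp: upper_conf_def)

lemma lead_in: "lead \<in> {1..K}" and c_in: "i \<in> {1..K} \<Longrightarrow> c i \<in> {1..Ks i}"
  using lead c[of i] by (auto simp: is_arg_max_def is_arg_min_def)

lemma L_c_le: "i \<in> {1..K} \<Longrightarrow> j \<in> {1..Ks i} \<Longrightarrow> L (i, c i) \<le> L (i, j)"
  using c[of i] by (auto simp: is_arg_min_def not_less)

lemma U_le_S: "i \<in> {1..K} \<Longrightarrow> i \<noteq> lead \<Longrightarrow> U (i, c i) \<le> U S"
  using S by (auto simp: is_arg_max_def not_less)

lemma S_eq: "\<exists>i\<in>{1..K}. i \<noteq> lead \<and> S = (i, c i)"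
  using S by (auto simp: is_arg_max_def)

lemma emp_lead:
  assumes "i \<in> {1..K}"
  shows "\<exists>j\<in>{1..Ks i}. emp_mean m0 h (i, j) \<le> emp_mean m0 h (lead, c lead)"
proof -
  define f where "f = (\<lambda>i. Min ((\<lambda>j. emp_mean m0 h (i, j)) ` {1..Ks i}))"
  have "f i \<in> (\<lambda>j. emp_mean m0 h (i, j)) ` {1..Ks i}"
    unfolding f_def using Ks[OF assms] by (intro Min_in) auto
  then obtain j where "j \<in> {1..Ks i}" "f i = emp_mean m0 h (i, j)" by auto
  moreover have "f i \<le> f lead"
    using lead assms by (auto simp: is_arg_max_def f_def not_less)
  moreover have "f lead \<le> emp_mean m0 h (lead, c lead)"
    unfolding f_def using c_in[OF lead_in] by (intro Min_le) auto
  ultimately show ?thesis by (auto intro!: bexI[of _ j])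
qed

lemma mean_mono: "i \<in> {1..K} \<Longrightarrow> j \<in> {1..Ks i} \<Longrightarrow> \<mu> (i, 1) \<le> \<mu> (i, j)"
  using inst Ks[of i] by (auto simp: bandit_instance_def monotone_on_def)

lemma mean_antimono: "i \<in> {2..K} \<Longrightarrow> \<mu> (i, 1) \<le> \<mu> (2, 1)"
  using inst K by (auto simp: bandit_instance_def monotone_on_def)

lemma mid_bounds: "\<mu> (2, 1) < mid" "mid < \<mu> (1, 1)"
  using gap by (auto simp: midpoint_def)

text \<open>A real number \<open>g\<close> strictly between the two bounds keeps their
  \<open>ereal\<close> difference away from undetermined forms with two infinities.\<close>

lemma stop_conditionI:
  assumes i: "i \<in> {1..K}"
    and U_less: "\<And>i'. i' \<in> {1..K} \<Longrightarrow> i' \<noteq> i \<Longrightarrow> U (i', c i') < ereal g"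
    and g: "ereal g < L (i, c i)"
  shows "stop_condition K Ks \<beta> m0 h"
proof -
  define V where "V = Max ((\<lambda>i'. Min ((\<lambda>j'. U (i', j')) ` {1..Ks i'})) ` ({1..K} - {i}))"
  define W where "W = Min ((\<lambda>j. L (i, j)) ` {1..Ks i})"
  \<comment> \<open>\<open>Max\<close> is unspecified on the empty set; having two actions ensures a
    competitor.\<close>
  have ne: "{1..K} - {i} \<noteq> {}"
  proof
    assume "{1..K} - {i} = {}"
    moreover have "1 \<in> {1..K}" "2 \<in> {1..K}" using K by auto
    ultimately show False by (metis DiffI empty_iff numeral_eq_one_iff semiring_norm(85) singletonD)
  qed
  have "V < ereal g"
    unfolding V_def
  proof (subst Max_less_iff)
    show "\<forall>a\<in>(\<lambda>i'. Min ((\<lambda>j'. U (i', j')) ` {1..Ks i'})) ` ({1..K} - {i}). a < ereal g"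
    proof
      fix a assume "a \<in> (\<lambda>i'. Min ((\<lambda>j'. U (i', j')) ` {1..Ks i'})) ` ({1..K} - {i})"
      then obtain i' where i': "i' \<in> {1..K}" "i' \<noteq> i"
        and a: "a = Min ((\<lambda>j'. U (i', j')) ` {1..Ks i'})" by blast
      have "Min ((\<lambda>j'. U (i', j')) ` {1..Ks i'}) \<le> U (i', c i')"
        using c_in[OF i'(1)] by (intro Min_le) auto
      with U_less[OF i'] show "a < ereal g" unfolding a by simp
    qed
  qed (use ne in auto)
  moreover have "ereal g < W"
    unfolding W_def
  proof (subst Min_gr_iff)
    show "\<forall>a\<in>(\<lambda>j. L (i, j)) ` {1..Ks i}. ereal g < a"
      using L_c_le[OF i] g by (auto intro: less_le_trans)
  qed (use Ks[OF i] in auto)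
  ultimately have "V - W < 0"
    by (cases V; cases W) auto
  moreover have "Min ((\<lambda>i. Max ((\<lambda>i'. Min ((\<lambda>j'. U (i', j')) ` {1..Ks i'})) ` ({1..K} - {i}))
               - Min ((\<lambda>j. L (i, j)) ` {1..Ks i})) ` {1..K}) \<le> V - W"
    unfolding V_def W_def using i by (intro Min_le) auto
  ultimately show ?thesis
    unfolding stop_condition_def by simp
qed

text \<open>The action attaining the negative minimum must be the empirical leader: otherwise the
  separation of the intervals would put the least empirical mean of the leader below that of this
  action. So the recommended action is the separated one.\<close>

lemma stop_conditionD:
  assumes "stop_condition K Ks \<beta> m0 h"
  shows "\<forall>j\<in>{1..Ks lead}. \<forall>i\<in>{1..K}. i \<noteq> lead \<longrightarrow> (\<exists>j'\<in>{1..Ks i}. U (i, j') < L (lead, j))"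
proof -
  define V where "V i = Max ((\<lambda>i'. Min ((\<lambda>j'. U (i', j')) ` {1..Ks i'})) ` ({1..K} - {i}))" for i
  define W where "W i = Min ((\<lambda>j. L (i, j)) ` {1..Ks i})" for i
  have "Min ((\<lambda>i. V i - W i) ` {1..K}) \<in> (\<lambda>i. V i - W i) ` {1..K}"
    using K by (intro Min_in) auto
  moreover have "Min ((\<lambda>i. V i - W i) ` {1..K}) < 0"
    using assms unfolding stop_condition_def V_def W_def by simp
  ultimately obtain i where i: "i \<in> {1..K}" and VW: "V i - W i < 0" by auto
  have "W i \<in> (\<lambda>j. L (i, j)) ` {1..Ks i}"
    unfolding W_def using Ks[OF i] by (intro Min_in) auto
  then have "W i \<noteq> \<infinity>" by (metis L_not_PInf imageE)
  with VW have less: "V i < W i"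
    by (cases "V i"; cases "W i") auto
  have *: "\<exists>j'\<in>{1..Ks i'}. U (i', j') < L (i, j)"
    if i': "i' \<in> {1..K}" "i' \<noteq> i" and j: "j \<in> {1..Ks i}" for i' j
  proof -
    have "Min ((\<lambda>j'. U (i', j')) ` {1..Ks i'}) \<in> (\<lambda>j'. U (i', j')) ` {1..Ks i'}"
      using Ks[OF i'(1)] by (intro Min_in) auto
    then obtain j' where j': "j' \<in> {1..Ks i'}" "Min ((\<lambda>j'. U (i', j')) ` {1..Ks i'}) = U (i', j')"
      by auto
    have "U (i', j') \<le> V i"
      unfolding V_def j'(2)[symmetric] using i' by (intro Max_ge) auto
    moreover have "W i \<le> L (i, j)"
      unfolding W_def using j by (intro Min_le) auto
    ultimately show ?thesis using less j'(1) by (metis le_less_trans less_le_trans)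
  qed
  have "lead = i"
  proof (rule ccontr)
    assume "lead \<noteq> i"
    define f where "f = (\<lambda>i. Min ((\<lambda>j. emp_mean m0 h (i, j)) ` {1..Ks i}))"
    have "f i \<in> (\<lambda>j. emp_mean m0 h (i, j)) ` {1..Ks i}"
      unfolding f_def using Ks[OF i] by (intro Min_in) auto
    then obtain j where j: "j \<in> {1..Ks i}" "f i = emp_mean m0 h (i, j)" by auto
    obtain j' where j': "j' \<in> {1..Ks lead}" "U (lead, j') < L (i, j)"
      using *[OF lead_in \<open>lead \<noteq> i\<close> j(1)] by auto
    have "ereal (f lead) \<le> ereal (emp_mean m0 h (lead, j'))"
      unfolding f_def using j' by (auto intro!: Min_le)
    also have "\<dots> \<le> U (lead, j')" by (rule emp_le_U)
    also have "\<dots> < L (i, j)" by (rule j')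
    also have "\<dots> \<le> ereal (f i)" unfolding j(2) by (rule L_le_emp)
    finally have "f lead < f i" by simp
    moreover have "f i \<le> f lead"
      using lead i by (auto simp: is_arg_max_def f_def not_less)
    ultimately show False by simp
  qed
  with * show ?thesis by auto
qed

text \<open>The two-interval argument: if neither interval of the two drawn arms contained the
  midpoint, then either the empirical maximin action would be separated from all others, or some
  interval would be invalid, or the leader would be misidentified.\<close>
lemma unstopped_straddles:
  assumes valid: "\<And>P. P \<in> arms K Ks \<Longrightarrow> valid P"
    and unstopped: "\<not> stop_condition K Ks \<beta> m0 h"
  shows "\<exists>P\<in>{(lead, c lead), S}. L P \<le> ereal mid \<and> ereal mid \<le> U P"
proof (rule ccontr)
  assume "\<not> ?thesis"
  then have H: "ereal mid < L (lead, c lead) \<or> U (lead, c lead) < ereal mid"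
    and S': "ereal mid < L S \<or> U S < ereal mid"
    by (auto simp: not_le)
  obtain i where i: "i \<in> {1..K}" "i \<noteq> lead" "S = (i, c i)" using S_eq by auto
  have L_mid: "k = 1" if "k \<in> {1..K}" "ereal mid < L (k, c k)" for k
  proof (rule ccontr)
    assume "k \<noteq> 1"
    have "(k, 1) \<in> arms K Ks" using Ks[of k] that by (auto simp: arms_def)
    from valid[OF this] have "L (k, 1) \<le> ereal (\<mu> (k, 1))" by (simp add: valid_def)
    moreover have "L (k, c k) \<le> L (k, 1)" using L_c_le[OF that(1), of 1] Ks[OF that(1)] by auto
    ultimately have "ereal mid < ereal (\<mu> (k, 1))"
      using that(2) by (meson less_le_trans order_trans)
    with mean_antimono[of k] mid_bounds that(1) \<open>k \<noteq> 1\<close> show False by auto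
  qed
  have U_mid: "k \<noteq> 1" if "U (k, c k) < ereal mid" for k
  proof
    assume "k = 1"
    have 1: "1 \<in> {1..K}" using K by auto
    then have "(1, c 1) \<in> arms K Ks" using c_in[OF 1] by (auto simp: arms_def)
    from valid[OF this] have "ereal (\<mu> (1, c 1)) \<le> U (1, c 1)" by (simp add: valid_def)
    with mean_mono[OF 1 c_in[OF 1]] mid_bounds that \<open>k = 1\<close> show False
      by (metis ereal_less_eq(3) le_less_trans less_le_trans linorder_not_less order_less_imp_le)
  qed
  \<comment> \<open>Both above: both actions would be 1, yet they differ. Leader above and
    challenger below: \<open>U S\<close> dominates the other candidates, so the stopping condition
    holds. Leader below and challenger above: the empirical means contradict the choice of the
    leader. Both below: so is an arm of action 1, whose mean exceeds the midpoint.\<close>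
  consider "ereal mid < L (lead, c lead)" "ereal mid < L S"
    | "ereal mid < L (lead, c lead)" "U S < ereal mid"
    | "U (lead, c lead) < ereal mid" "ereal mid < L S"
    | "U (lead, c lead) < ereal mid" "U S < ereal mid"
    using H S' by blast
  then show False
  proof cases
    case 1
    then show False using L_mid[OF lead_in] L_mid[OF i(1)] i by auto
  next
    case 2
    have "stop_condition K Ks \<beta> m0 h"
      using 2 by (intro stop_conditionI[OF lead_in, of mid]) (auto intro: le_less_trans[OF U_le_S])
    then show False using unstopped by simp
  next
    case 3
    obtain j where j: "j \<in> {1..Ks i}" "emp_mean m0 h (i, j) \<le> emp_mean m0 h (lead, c lead)"
      using emp_lead[OF i(1)] by auto
    have "ereal mid < L (i, c i)" using 3 i by simp
    also have "\<dots> \<le> L (i, j)" by (rule L_c_le[OF i(1) j(1)])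
    also have "\<dots> \<le> ereal (emp_mean m0 h (i, j))" by (rule L_le_emp)
    also have "\<dots> \<le> ereal (emp_mean m0 h (lead, c lead))" using j by simp
    also have "\<dots> \<le> U (lead, c lead)" by (rule emp_le_U)
    also have "\<dots> < ereal mid" using 3 by simp
    finally show False .
  next
    case 4
    have "U (1, c 1) < ereal mid"
    proof (cases "lead = 1")
      case False
      then have "U (1, c 1) \<le> U S" using U_le_S[of 1] K by auto
      with 4 show ?thesis by simp
    qed (use 4 in auto)
    then show False using U_mid[of 1] by simp
  qed
qed

text \<open>The interval of \<open>c i\<close> contains the midpoint, \<open>\<mu> (i, 1)\<close>
  and \<open>\<mu> (i, c i)\<close>: its lower end is at most \<open>L (i, 1)\<close> because
  \<open>c i\<close> minimises the lower bound, and its upper end is at least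
  \<open>\<mu> (i, c i)\<close>. So its length \<open>2 * w\<close> bounds both distances in
  \<open>gap_sq\<close>, and \<open>(2 * w)^2\<close> is 2 \<beta> / n.\<close>

lemma straddling_pulls:
  assumes valid: "\<And>P. P \<in> arms K Ks \<Longrightarrow> valid P"
    and i: "i \<in> {1..K}" and mid: "L (i, c i) \<le> ereal mid" "ereal mid \<le> U (i, c i)"
  shows "real (pulls h (i, c i)) * gap_sq \<mu> (i, c i) \<le> 2 * \<beta> (length h)"
proof (cases "pulls h (i, c i) = 0")
  case True
  then show ?thesis using rate by simp
next
  case False
  define n where "n = pulls h (i, c i)"
  define w where "w = sqrt (\<beta> (length h) / (2 * real n))"
  define x where "x = emp_mean m0 h (i, c i)"
  have n: "n > 0" using False by (simp add: n_def)
  have LU: "L (i, c i) = ereal (x - w)" "U (i, c i) = ereal (x + w)"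
    using False by (simp_all add: lower_conf_def upper_conf_def n_def w_def x_def)
  have w: "w \<ge> 0" using rate by (simp add: w_def)
  have "(i, 1) \<in> arms K Ks" "(i, c i) \<in> arms K Ks"
    using i Ks[OF i] c_in[OF i] by (auto simp: arms_def)
  note v = valid[OF this(1)] valid[OF this(2)]
  have "L (i, c i) \<le> L (i, 1)" using L_c_le[OF i, of 1] Ks[OF i] by auto
  also have "\<dots> \<le> ereal (\<mu> (i, 1))" using v by (simp add: valid_def)
  finally have 1: "x - w \<le> \<mu> (i, 1)" using LU by simp
  have 2: "\<mu> (i, c i) \<le> x + w" using v LU by (simp add: valid_def)
  have 3: "x - w \<le> mid" "mid \<le> x + w" using mid LU by auto
  have 4: "\<mu> (i, 1) \<le> \<mu> (i, c i)" by (rule mean_mono[OF i c_in[OF i]])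
  have "\<bar>\<mu> (i, 1) - mid\<bar> \<le> 2 * w"
  proof (cases "i = 1")
    case True
    then show ?thesis using 2 3 4 mid_bounds by auto
  next
    case False
    then show ?thesis using 1 3 mean_antimono[of i] i mid_bounds by auto
  qed
  then have 5: "(\<mu> (i, 1) - mid)\<^sup>2 \<le> (2 * w)\<^sup>2"
    using w abs_le_square_iff[of "\<mu> (i, 1) - mid" "2 * w"] by simp
  have "\<bar>\<mu> (i, c i) - \<mu> (i, 1)\<bar> \<le> 2 * w" using 1 2 4 by auto
  then have "(\<mu> (i, c i) - \<mu> (i, 1))\<^sup>2 \<le> (2 * w)\<^sup>2"
    using w abs_le_square_iff[of "\<mu> (i, c i) - \<mu> (i, 1)" "2 * w"] by simp
  with 5 have "gap_sq \<mu> (i, c i) \<le> (2 * w)\<^sup>2" by (simp add: gap_sq_def)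
  also have "\<dots> = 2 * \<beta> (length h) / real n"
  proof -
    have "w\<^sup>2 = \<beta> (length h) / (2 * real n)" using rate by (simp add: w_def)
    then show ?thesis by (simp add: power_mult_distrib)
  qed
  finally show ?thesis using n by (simp add: n_def field_simps)
qed

lemma unstopped_pulls:
  assumes "\<And>P. P \<in> arms K Ks \<Longrightarrow> valid P" "\<not> stop_condition K Ks \<beta> m0 h"
  shows "\<exists>P\<in>{(lead, c lead), S}. P \<in> arms K Ks \<and> real (pulls h P) * gap_sq \<mu> P \<le> 2 * \<beta> (length h)"
proof -
  obtain P where P: "P \<in> {(lead, c lead), S}" "L P \<le> ereal mid" "ereal mid \<le> U P"
    using unstopped_straddles[OF assms] by blast
  obtain i where i: "i \<in> {1..K}" "P = (i, c i)"
    using P(1) S_eq lead_in by auto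
  have "P \<in> arms K Ks" using i c_in[OF i(1)] by (auto simp: arms_def)
  with straddling_pulls[OF assms(1) i(1)] P i show ?thesis by auto
qed

end

subsection \<open>Runs of the algorithm\<close>

locale mlucb_run =
  fixes K :: nat and Ks :: "nat \<Rightarrow> nat" and \<mu> :: "arm \<Rightarrow> real"
    and \<beta> :: "nat \<Rightarrow> real" and R :: "'s measure" and A :: "'s mlucb_choice"
  assumes K: "K \<ge> 2" and Ks: "i \<in> {1..K} \<Longrightarrow> Ks i \<ge> 1"
    and inst: "bandit_instance K Ks \<mu>" and gap: "\<mu> (1, 1) > \<mu> (2, 1)"
    and rate_0: "\<beta> 0 \<ge> 0" and rate_mono: "m \<le> n \<Longrightarrow> \<beta> (2 * m) \<le> \<beta> (2 * n)"
    and R: "prob_space R" and mlucb: "is_mlucb K Ks \<beta> R A"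
begin

text \<open>Here and below \<open>m\<close> counts pairs of rounds, so that it stands for the time \<open>2 m\<close>.\<close>
abbreviation hist :: "'s \<Rightarrow> (arm \<times> nat \<Rightarrow> bool) \<Rightarrow> nat \<Rightarrow> history" where
  "hist u Y m \<equiv> bandit_history (mlucb_policy A u) Y (2 * m)"

abbreviation "stops \<equiv> stop_condition K Ks \<beta> (init_mean A)"

definition drawn :: "'s \<Rightarrow> history \<Rightarrow> arm set" where
  "drawn u h = {(leader A u h, cand A u h (leader A u h)), challenger A u h}"

lemma rate_nonneg: "\<beta> (2 * m) \<ge> 0"
  using rate_0 rate_mono[of 0 m] by simp

lemma decision:
  assumes "u \<in> space R"
  shows "mlucb_decision K Ks \<mu> \<beta> (init_mean A) (hist u Y m)
    (leader A u (hist u Y m)) (cand A u (hist u Y m)) (challenger A u (hist u Y m))"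
proof -
  define h where "h = hist u Y m"
  have "even (length h)" "length h = 2 * m" by (simp_all add: h_def)
  with mlucb assms show ?thesis
    unfolding h_def[symmetric] is_mlucb_def mlucb_decision_def
    using K Ks inst gap rate_nonneg[of m] by auto
qed

text \<open>The leader's arm and the challenger belong to different actions, so no arm is drawn
  twice within a pair of rounds. This gives \<open>pulls_le\<close>, with \<open>m\<close> rather
  than \<open>2 * m\<close>.\<close>

lemma pulls_Suc:
  assumes "u \<in> space R"
  shows "pulls (hist u Y (Suc m)) P = pulls (hist u Y m) P + of_bool (P \<in> drawn u (hist u Y m))"
proof -
  interpret mlucb_decision K Ks \<mu> \<beta> "init_mean A" "hist u Y m"
    "leader A u (hist u Y m)" "cand A u (hist u Y m)" "challenger A u (hist u Y m)"
    by (rule decision[OF assms])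
  show ?thesis
    using S_eq unfolding pulls_two_rounds drawn_def by (auto simp del: bandit_history.simps)
qed

lemma pulls_le: "u \<in> space R \<Longrightarrow> pulls (hist u Y m) P \<le> m"
proof (induction m)
  case (Suc m)
  then show ?case unfolding pulls_Suc[OF Suc.prems] by simp
qed simp

lemma gap_sq_pos: "P \<in> arms K Ks \<Longrightarrow> gap_sq \<mu> P > 0"
proof -
  assume P: "P \<in> arms K Ks"
  then have i: "fst P \<in> {1..K}" by (auto simp: arms_def)
  have "\<mu> (fst P, 1) \<noteq> midpoint \<mu>"
  proof (cases "fst P = 1")
    case False
    then have "\<mu> (fst P, 1) \<le> \<mu> (2, 1)"
      using inst i K by (auto simp: bandit_instance_def monotone_on_def)
    then show ?thesis using gap by (simp add: midpoint_def)
  qed (use gap in \<open>simp add: midpoint_def\<close>)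
  then show ?thesis by (simp add: gap_sq_def less_max_iff_disj)
qed

section \<open>Counting the pairs of rounds before stopping\<close>

definition valid_at :: "'s \<Rightarrow> (arm \<times> nat \<Rightarrow> bool) \<Rightarrow> nat \<Rightarrow> arm \<Rightarrow> bool" where
  "valid_at u Y m = mlucb_decision.valid \<mu> \<beta> (init_mean A) (hist u Y m)"

text \<open>Each draw of \<open>P\<close> raises its count, so the counts at the times in the set
  are distinct integers between 0 and \<open>x\<close>.\<close>

lemma card_undersampled_draws:
  assumes "u \<in> space R" "P \<in> arms K Ks" "x \<ge> 0"
  shows "real (card {m. m < M \<and> P \<in> drawn u (hist u Y m) \<and> real (pulls (hist u Y m) P) \<le> x}) \<le> x + 1"
    (is "real (card ?G) \<le> _")
proof -
  define d where "d m = pulls (hist u Y m) P" for m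
  have d_mono: "d m \<le> d n" if "m \<le> n" for m n
    unfolding d_def using that by (intro pulls_bandit_history_mono) auto
  have less: "d m < d n" if "m \<in> ?G" "m < n" for m n
  proof -
    have "d (Suc m) = d m + 1" using that pulls_Suc[OF assms(1)] by (simp add: d_def)
    moreover have "d (Suc m) \<le> d n" using that by (intro d_mono) auto
    ultimately show ?thesis by simp
  qed
  have inj: "inj_on d ?G"
  proof (rule linorder_inj_onI')
    fix i j assume "i \<in> ?G" "i < j"
    from less[OF this] show "d i \<noteq> d j" by simp
  qed
  have "d ` ?G \<subseteq> {..nat \<lfloor>x\<rfloor>}"
    by (auto simp: d_def le_nat_floor)
  then have "card ?G \<le> nat \<lfloor>x\<rfloor> + 1"
    using card_mono[of "{..nat \<lfloor>x\<rfloor>}" "d ` ?G"] card_image[OF inj] by simp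
  then show ?thesis using assms(3) by linarith
qed

text \<open>By \<open>unstopped_pulls\<close>, each unstopped time without an invalid interval can
  be charged to an arm drawn there that has few draws so far. Monotonicity of the rate gives the
  common threshold \<open>x P\<close>, and each arm is charged at most \<open>x P + 1\<close>
  times.\<close>

lemma unstopped_count:
  assumes u: "u \<in> space R" and unstopped: "\<And>m. m < M \<Longrightarrow> \<not> stops (hist u Y m)"
  shows "real M \<le> 2 * \<beta> (2 * M) * (\<Sum>P\<in>arms K Ks. 1 / gap_sq \<mu> P) + card (arms K Ks)
    + real (card {m. m < M \<and> (\<exists>P\<in>arms K Ks. \<not> valid_at u Y m P)})" (is "_ \<le> _ + real (card ?B)")
proof -
  define x where "x P = 2 * \<beta> (2 * M) / gap_sq \<mu> P" for P
  define G where
    "G P = {m. m < M \<and> P \<in> drawn u (hist u Y m) \<and> real (pulls (hist u Y m) P) \<le> x P}" for P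
  have "{..<M} \<subseteq> ?B \<union> (\<Union>P\<in>arms K Ks. G P)"
  proof
    fix m assume "m \<in> {..<M}"
    then have m: "m < M" by simp
    show "m \<in> ?B \<union> (\<Union>P\<in>arms K Ks. G P)"
    proof (cases "\<exists>P\<in>arms K Ks. \<not> valid_at u Y m P")
      case False
      interpret mlucb_decision K Ks \<mu> \<beta> "init_mean A" "hist u Y m"
        "leader A u (hist u Y m)" "cand A u (hist u Y m)" "challenger A u (hist u Y m)"
        by (rule decision[OF u])
      have "\<And>P. P \<in> arms K Ks \<Longrightarrow> valid P"
        using False by (simp add: valid_at_def)
      from unstopped_pulls[OF this unstopped[OF m]]
      obtain P where P: "P \<in> drawn u (hist u Y m)" "P \<in> arms K Ks"
        "real (pulls (hist u Y m) P) * gap_sq \<mu> P \<le> 2 * \<beta> (2 * m)"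
        unfolding drawn_def length_bandit_history by blast
      have "real (pulls (hist u Y m) P) * gap_sq \<mu> P \<le> 2 * \<beta> (2 * M)"
        using P(3) rate_mono[of m M] m by linarith
      then have "real (pulls (hist u Y m) P) \<le> x P"
        using gap_sq_pos[OF P(2)] by (simp add: x_def field_simps)
      then show ?thesis using P m by (auto simp: G_def)
    qed (use m in auto)
  qed
  moreover have fin: "finite ?B" "finite (\<Union>P\<in>arms K Ks. G P)"
    by (auto simp: G_def)
  ultimately have "M \<le> card (?B \<union> (\<Union>P\<in>arms K Ks. G P))"
    using card_mono[of "?B \<union> (\<Union>P\<in>arms K Ks. G P)" "{..<M}"] by (simp del: UN_simps)
  also have "\<dots> \<le> card ?B + card (\<Union>P\<in>arms K Ks. G P)"
    by (rule card_Un_le)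
  also have "card (\<Union>P\<in>arms K Ks. G P) \<le> (\<Sum>P\<in>arms K Ks. card (G P))"
    by (rule card_UN_le) simp
  finally have "real M \<le> real (card ?B) + (\<Sum>P\<in>arms K Ks. real (card (G P)))"
    by (simp flip: of_nat_sum of_nat_add)
  also have "(\<Sum>P\<in>arms K Ks. real (card (G P))) \<le> (\<Sum>P\<in>arms K Ks. x P + 1)"
    unfolding G_def using rate_nonneg gap_sq_pos
    by (intro sum_mono card_undersampled_draws[OF u]) (auto simp: x_def less_imp_le)
  also have "\<dots> = 2 * \<beta> (2 * M) * (\<Sum>P\<in>arms K Ks. 1 / gap_sq \<mu> P) + card (arms K Ks)"
    by (simp add: sum.distrib x_def sum_distrib_left)
  finally show ?thesis by simp
qed

definition deviates :: "(arm \<times> nat \<Rightarrow> bool) \<Rightarrow> nat \<Rightarrow> arm \<Rightarrow> nat \<Rightarrow> bool" where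
  "deviates Y m P n \<longleftrightarrow> \<bar>sample_mean Y P n - \<mu> P\<bar> \<ge> sqrt (\<beta> (2 * m) / (2 * real n))"

text \<open>An arm without draws has the whole line as its interval, so an invalid interval has some
  number of draws between 1 and \<open>m\<close>, and that number is a witness.\<close>

lemma invalid_deviates:
  assumes u: "u \<in> space R" and "\<not> valid_at u Y m P"
  shows "\<exists>n\<in>{1..m}. deviates Y m P n"
proof -
  interpret mlucb_decision K Ks \<mu> \<beta> "init_mean A" "hist u Y m"
    "leader A u (hist u Y m)" "cand A u (hist u Y m)" "challenger A u (hist u Y m)"
    by (rule decision[OF u])
  define n where "n = pulls (hist u Y m) P"
  have "n > 0"
  proof (rule ccontr)
    assume "\<not> n > 0"
    then show False using assms(2)
      by (simp add: n_def valid_at_def valid_def lower_conf_def upper_conf_def)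
  qed
  then have "emp_mean (init_mean A) (hist u Y m) P = sample_mean Y P n"
    unfolding n_def by (rule emp_mean_bandit_history)
  with assms(2) \<open>n > 0\<close> have "deviates Y m P n"
    by (auto simp: valid_at_def valid_def lower_conf_def upper_conf_def deviates_def n_def)
  moreover have "n \<le> m" unfolding n_def by (rule pulls_le[OF u])
  ultimately show ?thesis using \<open>n > 0\<close> by force
qed

text \<open>Bounds the number of times with an invalid interval by a quantity of the reward table
  alone, for all policies and horizons at once. With values in \<open>ennreal\<close>, sums and
  integrals can be exchanged freely.\<close>

definition bad_count :: "(arm \<times> nat \<Rightarrow> bool) \<Rightarrow> ennreal" where
  "bad_count Y = (\<Sum>m. \<Sum>P\<in>arms K Ks. \<Sum>n\<in>{1..m}. of_bool (deviates Y m P n))"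

lemma card_invalid_le:
  assumes u: "u \<in> space R"
  shows "of_nat (card {m. m < M \<and> (\<exists>P\<in>arms K Ks. \<not> valid_at u Y m P)}) \<le> bad_count Y"
proof -
  have "of_nat (card {m. m < M \<and> (\<exists>P\<in>arms K Ks. \<not> valid_at u Y m P)})
      = (\<Sum>m<M. of_bool (\<exists>P\<in>arms K Ks. \<not> valid_at u Y m P) :: ennreal)"
  proof -
    have "{m. m < M \<and> (\<exists>P\<in>arms K Ks. \<not> valid_at u Y m P)}
        = {..<M} \<inter> {m. \<exists>P\<in>arms K Ks. \<not> valid_at u Y m P}" by auto
    then show ?thesis by simp
  qed
  also have "\<dots> \<le> (\<Sum>m<M. \<Sum>P\<in>arms K Ks. \<Sum>n\<in>{1..m}. of_bool (deviates Y m P n))"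
  proof (intro sum_mono)
    fix m
    show "of_bool (\<exists>P\<in>arms K Ks. \<not> valid_at u Y m P)
      \<le> (\<Sum>P\<in>arms K Ks. \<Sum>n\<in>{1..m}. of_bool (deviates Y m P n) :: ennreal)"
    proof (cases "\<exists>P\<in>arms K Ks. \<not> valid_at u Y m P")
      case True
      then obtain P n where P: "P \<in> arms K Ks" "n \<in> {1..m}" "deviates Y m P n"
        using invalid_deviates[OF u] by blast
      have "1 = (of_bool (deviates Y m P n) :: ennreal)" using P by simp
      also have "\<dots> \<le> (\<Sum>n\<in>{1..m}. of_bool (deviates Y m P n))"
        by (rule member_le_sum) (use P in auto)
      also have "\<dots> \<le> (\<Sum>P\<in>arms K Ks. \<Sum>n\<in>{1..m}. of_bool (deviates Y m P n))"
        using P by (intro member_le_sum[where f = "\<lambda>P. \<Sum>n\<in>{1..m}. of_bool (deviates Y m P n)"])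
          (auto intro!: sum_nonneg)
      finally show ?thesis using True by simp
    qed simp
  qed
  also have "\<dots> \<le> bad_count Y"
    unfolding bad_count_def by (intro sum_le_suminf) auto
  finally show ?thesis .
qed

end

subsection \<open>Concentration of the reward table\<close>

abbreviation table_space :: "nat \<Rightarrow> (nat \<Rightarrow> nat) \<Rightarrow> (arm \<Rightarrow> real) \<Rightarrow> (arm \<times> nat \<Rightarrow> bool) measure" where
  "table_space K Ks \<mu> \<equiv> \<Pi>\<^sub>M (P, n) \<in> arms K Ks \<times> UNIV. measure_pmf (bernoulli_pmf (\<mu> P))"

lemma prob_space_table: "prob_space (table_space K Ks \<mu>)"
  by (intro prob_space_PiM) (auto intro: prob_space_measure_pmf)

text \<open>For \<open>P\<close> outside \<open>arms\<close> the coordinate is constantly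
  \<open>undefined\<close> on the extensional product space. Stating this for all \<open>P\<close>
  allows countable case distinctions over the type of arms.\<close>

lemma measurable_table [measurable]:
  "(\<lambda>Y. Y (P, n)) \<in> table_space K Ks \<mu> \<rightarrow>\<^sub>M count_space UNIV"
proof (cases "P \<in> arms K Ks")
  case True
  then have "(\<lambda>Y. Y (P, n)) \<in> table_space K Ks \<mu> \<rightarrow>\<^sub>M
      (case (P, n) of (P, n) \<Rightarrow> measure_pmf (bernoulli_pmf (\<mu> P)))"
    by (intro measurable_component_singleton) auto
  then show ?thesis by simp
next
  case False
  then have "Y (P, n) = undefined" if "Y \<in> space (table_space K Ks \<mu>)" for Y
    using that False by (intro extensional_arb[of _ "arms K Ks \<times> UNIV"]) (auto simp: space_PiM PiE_def)
  then show ?thesis by (subst measurable_cong[where g = "\<lambda>_. undefined"]) auto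
qed

lemma measurable_sample_mean [measurable]:
  "(\<lambda>Y. sample_mean Y P n) \<in> borel_measurable (table_space K Ks \<mu>)"
  unfolding sample_mean_def by measurable

text \<open>On the extensional product space, restricting to the index set is the identity, so the
  joint law of the coordinates is the product measure itself.\<close>

lemma indep_vars_table:
  assumes "arms K Ks \<noteq> {}"
  shows "prob_space.indep_vars (table_space K Ks \<mu>) (\<lambda>(P, n). measure_pmf (bernoulli_pmf (\<mu> P)))
     (\<lambda>i Y. Y i) (arms K Ks \<times> UNIV)"
proof -
  let ?M = "\<lambda>(P, n). measure_pmf (bernoulli_pmf (\<mu> P))"
  interpret prob_space "table_space K Ks \<mu>" by (rule prob_space_table)
  have "distr (table_space K Ks \<mu>) (table_space K Ks \<mu>) (\<lambda>Y. \<lambda>i\<in>arms K Ks \<times> UNIV. Y i)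
      = distr (table_space K Ks \<mu>) (table_space K Ks \<mu>) (\<lambda>Y. Y)"
    by (intro distr_cong) (auto simp: space_PiM PiE_def extensional_restrict)
  also have "\<dots> = PiM (arms K Ks \<times> UNIV) (\<lambda>i. distr (table_space K Ks \<mu>) (?M i) (\<lambda>Y. Y i))"
    unfolding distr_id2[OF refl]
    by (intro PiM_cong refl distr_PiM_component[symmetric]) (auto intro: prob_space_measure_pmf)
  finally show ?thesis
    using assms by (subst indep_vars_iff_distr_eq_PiM') auto
qed

lemma expectation_table:
  assumes "P \<in> arms K Ks" "0 \<le> \<mu> P" "\<mu> P \<le> 1"
  shows "(\<integral>Y. of_bool (Y (P, n)) \<partial>table_space K Ks \<mu>) = \<mu> P"
proof -
  let ?M = "\<lambda>(P, n). measure_pmf (bernoulli_pmf (\<mu> P))"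
  have "distr (table_space K Ks \<mu>) (?M (P, n)) (\<lambda>Y. Y (P, n)) = ?M (P, n)"
    using assms(1) by (intro distr_PiM_component) (auto intro: prob_space_measure_pmf)
  then have "(\<integral>b. (of_bool b :: real) \<partial>measure_pmf (bernoulli_pmf (\<mu> P)))
      = (\<integral>Y. of_bool (Y (P, n)) \<partial>table_space K Ks \<mu>)"
    using integral_distr[of "\<lambda>Y. Y (P, n)" "table_space K Ks \<mu>" "?M (P, n)" "of_bool :: bool \<Rightarrow> real"]
      measurable_table[of P n K Ks \<mu>] by simp
  then show ?thesis using assms by simp
qed

text \<open>The first \<open>n\<close> entries of a row are independent with the same Bernoulli law.
  For \<open>w = sqrt (r / (2 * n))\<close>, the half-width at rate \<open>r\<close>, the
  exponential becomes \<open>exp (- r)\<close>.\<close>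

lemma Hoeffding_sample_mean:
  assumes P: "P \<in> arms K Ks" "0 \<le> \<mu> P" "\<mu> P \<le> 1" and n: "n > 0" and w: "w \<ge> 0"
  shows "measure (table_space K Ks \<mu>) {Y \<in> space (table_space K Ks \<mu>). sample_mean Y P n \<ge> \<mu> P + w}
      \<le> exp (- 2 * real n * w\<^sup>2)" (is ?ge)
    and "measure (table_space K Ks \<mu>) {Y \<in> space (table_space K Ks \<mu>). sample_mean Y P n \<le> \<mu> P - w}
      \<le> exp (- 2 * real n * w\<^sup>2)" (is ?le)
    and "measure (table_space K Ks \<mu>) {Y \<in> space (table_space K Ks \<mu>). \<bar>sample_mean Y P n - \<mu> P\<bar> \<ge> w}
      \<le> 2 * exp (- 2 * real n * w\<^sup>2)" (is ?abs_ge)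
proof -
  interpret prob_space "table_space K Ks \<mu>" by (rule prob_space_table)
  let ?X = "\<lambda>i Y. of_bool (Y i) :: real" and ?I = "Pair P ` {..<n}"
  have inj: "inj_on (Pair P) {..<n}" by (simp add: inj_on_def)
  have distr: "distr (table_space K Ks \<mu>) borel (?X (P, k)) = distr (table_space K Ks \<mu>) borel (?X (P, 0))" for k
  proof -
    have "distr (table_space K Ks \<mu>) borel (?X (P, k))
        = distr (measure_pmf (bernoulli_pmf (\<mu> P))) borel of_bool" for k
    proof -
      let ?M = "\<lambda>(P, n). measure_pmf (bernoulli_pmf (\<mu> P))"
      have "distr (distr (table_space K Ks \<mu>) (?M (P, k)) (\<lambda>Y. Y (P, k))) borel of_bool
          = distr (table_space K Ks \<mu>) borel (?X (P, k))"
        using measurable_table[of P k K Ks \<mu>] by (subst distr_distr) (auto simp: comp_def)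
      moreover have "distr (table_space K Ks \<mu>) (?M (P, k)) (\<lambda>Y. Y (P, k)) = ?M (P, k)"
        using P(1) by (intro distr_PiM_component) (auto intro: prob_space_measure_pmf)
      ultimately show ?thesis by simp
    qed
    then show ?thesis by metis
  qed
  have "indep_vars (\<lambda>(P, n). measure_pmf (bernoulli_pmf (\<mu> P))) (\<lambda>i Y. Y i) ?I"
    using P(1) by (intro indep_vars_subset[OF indep_vars_table]) auto
  then have indep: "indep_vars (\<lambda>_. borel) ?X ?I"
    by (rule indep_vars_compose2) auto
  interpret Hoeffding_ineq_iid "table_space K Ks \<mu>" ?I ?X "?X (P, 0)" 0 1 "\<mu> P"
  proof unfold_locales
    fix i assume "i \<in> ?I"
    then show "distr (table_space K Ks \<mu>) borel (?X i) = distr (table_space K Ks \<mu>) borel (?X (P, 0))"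
      using distr by blast
  qed (use indep expectation_table[where \<mu> = \<mu>, OF P, of 0] in auto)
  show ?ge
    using Hoeffding_ineq_ge'[OF w] n by (simp add: sample_mean_def lessThan_empty_iff sum.reindex[OF inj] card_image[OF inj])
  show ?le
    using Hoeffding_ineq_le'[OF w] n by (simp add: sample_mean_def lessThan_empty_iff sum.reindex[OF inj] card_image[OF inj])
  show ?abs_ge
    using Hoeffding_ineq_abs_ge'[OF w] n by (simp add: sample_mean_def lessThan_empty_iff sum.reindex[OF inj] card_image[OF inj])
qed

subsection \<open>Measurability\<close>

lemma measurable_mlucb_policy:
  assumes "is_mlucb K Ks \<beta> R A"
  shows "(\<lambda>u. mlucb_policy A u h) \<in> R \<rightarrow>\<^sub>M count_space UNIV"
proof -
  have [measurable]: "(\<lambda>u. cand A u h i) \<in> R \<rightarrow>\<^sub>M count_space UNIV"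
    "(\<lambda>u. leader A u h) \<in> R \<rightarrow>\<^sub>M count_space UNIV"
    "(\<lambda>u. challenger A u h) \<in> R \<rightarrow>\<^sub>M count_space UNIV" for h i
    using assms by (auto simp: is_mlucb_def)
  have "(\<lambda>u. cand A u h (leader A u h)) \<in> R \<rightarrow>\<^sub>M count_space UNIV"
    by (rule measurable_compose_countable[where f = "\<lambda>i u. cand A u h i" and g = "\<lambda>u. leader A u h"])
      measurable
  then show ?thesis
    unfolding mlucb_policy_def by (cases "even (length h)") simp_all
qed

text \<open>Histories and arms are countable types, so one step may be checked for each fixed
  history and then for each fixed arm.\<close>

lemma measurable_mlucb_history:
  assumes "is_mlucb K Ks \<beta> R A"
  shows "(\<lambda>\<omega>. mlucb_history A \<omega> t) \<in> bandit_space K Ks R \<mu> \<rightarrow>\<^sub>M count_space UNIV"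
  unfolding mlucb_history_def bandit_space_def
proof (induction t)
  case 0
  then show ?case by simp
next
  case (Suc t)
  let ?N = "R \<Otimes>\<^sub>M table_space K Ks \<mu>"
  have [measurable]: "(\<lambda>u. mlucb_policy A u h) \<in> R \<rightarrow>\<^sub>M count_space UNIV" for h
    by (rule measurable_mlucb_policy[OF assms])
  have [measurable]: "(\<lambda>\<omega>. snd \<omega> (P, n)) \<in> ?N \<rightarrow>\<^sub>M count_space UNIV" for P n
    using measurable_compose[OF measurable_snd measurable_table] .
  define step where "step h \<omega> = h @ [(mlucb_policy A (fst \<omega>) h, snd \<omega> (mlucb_policy A (fst \<omega>) h,
    pulls h (mlucb_policy A (fst \<omega>) h)))]" for h and \<omega> :: "'a \<times> (arm \<times> nat \<Rightarrow> bool)"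
  have "step h \<in> ?N \<rightarrow>\<^sub>M count_space UNIV" for h
    unfolding step_def
  proof (rule measurable_compose_countable[where f = "\<lambda>P \<omega>. h @ [(P, snd \<omega> (P, pulls h P))]"
          and g = "\<lambda>\<omega>. mlucb_policy A (fst \<omega>) h"])
    show "(\<lambda>\<omega>. h @ [(P, snd \<omega> (P, pulls h P))]) \<in> ?N \<rightarrow>\<^sub>M count_space UNIV" for P
      by (rule measurable_compose[where f = "\<lambda>\<omega>. snd \<omega> (P, pulls h P)" and g = "\<lambda>b. h @ [(P, b)]"])
        measurable
  qed measurable
  then have "(\<lambda>\<omega>. step (bandit_history (mlucb_policy A (fst \<omega>)) (snd \<omega>) t) \<omega>) \<in> ?N \<rightarrow>\<^sub>M count_space UNIV"
    by (rule measurable_compose_countable[where f = step, OF _ Suc.IH])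
  then show ?case by (simp only: step_def bandit_history.simps Let_def)
qed

lemma measurable_stop_time:
  assumes "is_mlucb K Ks \<beta> R A"
  shows "stop_time K Ks \<beta>' A \<in> bandit_space K Ks R \<mu> \<rightarrow>\<^sub>M count_space UNIV"
proof -
  \<comment> \<open>A countable infimum of functions of the history, each of which is
    measurable.\<close>
  have "stop_time K Ks \<beta>' A =
    (\<lambda>\<omega>. INF t. if even t \<and> stop_condition K Ks \<beta>' (init_mean A) (mlucb_history A \<omega> t)
      then enat t else \<infinity>)"
  proof
    fix \<omega>
    show "stop_time K Ks \<beta>' A \<omega> = (INF t. if even t \<and> stop_condition K Ks \<beta>' (init_mean A) (mlucb_history A \<omega> t)
      then enat t else \<infinity>)"
      unfolding stop_time_def
    proof (rule antisym)
      show "Inf {enat t |t. even t \<and> stop_condition K Ks \<beta>' (init_mean A) (mlucb_history A \<omega> t)}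
        \<le> (INF t. if even t \<and> stop_condition K Ks \<beta>' (init_mean A) (mlucb_history A \<omega> t) then enat t else \<infinity>)"
        by (rule INF_greatest) (auto intro: Inf_lower)
      show "(INF t. if even t \<and> stop_condition K Ks \<beta>' (init_mean A) (mlucb_history A \<omega> t) then enat t else \<infinity>)
        \<le> Inf {enat t |t. even t \<and> stop_condition K Ks \<beta>' (init_mean A) (mlucb_history A \<omega> t)}"
      proof (rule Inf_greatest)
        fix x assume "x \<in> {enat t |t. even t \<and> stop_condition K Ks \<beta>' (init_mean A) (mlucb_history A \<omega> t)}"
        then obtain t where t: "x = enat t" "even t \<and> stop_condition K Ks \<beta>' (init_mean A) (mlucb_history A \<omega> t)"
          by blast
        show "(INF t. if even t \<and> stop_condition K Ks \<beta>' (init_mean A) (mlucb_history A \<omega> t) then enat t else \<infinity>) \<le> x"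
          by (rule INF_lower2[of t]) (simp_all add: t)
      qed
    qed
  qed
  also have "\<dots> \<in> bandit_space K Ks R \<mu> \<rightarrow>\<^sub>M count_space UNIV"
    by (intro measurable_INF measurable_compose[OF measurable_mlucb_history[OF assms]]) auto
  finally show ?thesis .
qed

lemma measurable_recommendation:
  assumes "is_mlucb K Ks \<beta> R A"
  shows "recommendation K Ks \<beta>' A \<in> bandit_space K Ks R \<mu> \<rightarrow>\<^sub>M count_space UNIV"
proof -
  have [measurable]: "(\<lambda>u. leader A u h) \<in> R \<rightarrow>\<^sub>M count_space UNIV" for h
    using assms by (simp add: is_mlucb_def)
  have "(\<lambda>\<omega>. leader A (fst \<omega>) h) \<in> bandit_space K Ks R \<mu> \<rightarrow>\<^sub>M count_space UNIV" for h
    unfolding bandit_space_def by measurable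
  moreover have "(\<lambda>\<omega>. mlucb_history A \<omega> (the_enat (stop_time K Ks \<beta>' A \<omega>)))
      \<in> bandit_space K Ks R \<mu> \<rightarrow>\<^sub>M count_space UNIV"
  proof (rule measurable_compose_countable[where f = "\<lambda>t \<omega>. mlucb_history A \<omega> t"
        and g = "\<lambda>\<omega>. the_enat (stop_time K Ks \<beta>' A \<omega>)"])
    show "(\<lambda>\<omega>. the_enat (stop_time K Ks \<beta>' A \<omega>)) \<in> bandit_space K Ks R \<mu> \<rightarrow>\<^sub>M count_space UNIV"
      by (rule measurable_compose[OF measurable_stop_time[OF assms]]) simp
  qed (rule measurable_mlucb_history[OF assms])
  ultimately show ?thesis
    unfolding recommendation_def
    by (rule measurable_compose_countable[where f = "\<lambda>h \<omega>. leader A (fst \<omega>) h"])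
qed

subsection \<open>Expected stopping time\<close>

context mlucb_run
begin

lemma prob_space_bandit: "prob_space (bandit_space K Ks R \<mu>)"
  unfolding bandit_space_def by (intro prob_space_pair R prob_space_table)

lemma mean_bounds: "P \<in> arms K Ks \<Longrightarrow> 0 \<le> \<mu> P \<and> \<mu> P \<le> 1"
  using inst by (auto simp: bandit_instance_def)

lemma stop_time_cases:
  obtains "stop_time K Ks \<beta> A \<omega> = \<infinity>"
  | M where "stop_time K Ks \<beta> A \<omega> = enat (2 * M)" "stops (hist (fst \<omega>) (snd \<omega>) M)"
proof (cases "stop_time K Ks \<beta> A \<omega> = \<infinity>")
  case False
  let ?S = "{enat t | t. even t \<and> stops (mlucb_history A \<omega> t)}"
  have "Inf ?S \<noteq> \<infinity>" using False unfolding stop_time_def .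
  then have "Inf ?S = (LEAST x. x \<in> ?S)" "\<exists>x. x \<in> ?S"
    unfolding Inf_enat_def by (presburger, metis (no_types, lifting) all_not_in_conv)
  then have "stop_time K Ks \<beta> A \<omega> \<in> ?S"
    unfolding stop_time_def using LeastI_ex[of "\<lambda>x. x \<in> ?S"] by presburger
  then show ?thesis using that(2) by (auto simp: mlucb_history_def elim!: evenE)
qed (use that in auto)

lemma unstopped_before_stop_time:
  assumes "enat (2 * M) \<le> stop_time K Ks \<beta> A \<omega>" "m < M"
  shows "\<not> stops (hist (fst \<omega>) (snd \<omega>) m)"
proof
  assume "stops (hist (fst \<omega>) (snd \<omega>) m)"
  then have "stop_time K Ks \<beta> A \<omega> \<le> enat (2 * m)"
    unfolding stop_time_def mlucb_history_def by (intro Inf_lower) auto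
  with assms(1) have "enat (2 * M) \<le> enat (2 * m)" by (rule order_trans)
  with assms(2) show False by simp
qed

text \<open>With \<open>z\<close> invalid times, \<open>unstopped_count\<close> and
  \<open>bound\<close> give M \<le> a + (1 - q) M + z, hence q M \<le> a + z; the factor 2 converts
  pairs of rounds into time. The closer \<open>q\<close> is to 1, the less is lost in the leading
  constant.\<close>

lemma ennreal_stop_time_le:
  assumes "fst \<omega> \<in> space R" and q: "q > 0" and a: "a \<ge> 0"
    and bound: "\<And>M. M \<ge> 1 \<Longrightarrow>
      2 * \<beta> (2 * M) * (\<Sum>P\<in>arms K Ks. 1 / gap_sq \<mu> P) + card (arms K Ks) \<le> a + (1 - q) * M"
  shows "ennreal_of_enat (stop_time K Ks \<beta> A \<omega>) \<le> ennreal (2 * a / q) + ennreal (2 / q) * bad_count (snd \<omega>)"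
    (is "_ \<le> ?b")
proof -
  have *: "ennreal (2 * M) \<le> ?b" if M: "enat (2 * M) \<le> stop_time K Ks \<beta> A \<omega>" for M :: nat
  proof (cases "M = 0")
    case False
    define z where "z = card {m. m < M \<and> (\<exists>P\<in>arms K Ks. \<not> valid_at (fst \<omega>) (snd \<omega>) m P)}"
    have "real M \<le> 2 * \<beta> (2 * M) * (\<Sum>P\<in>arms K Ks. 1 / gap_sq \<mu> P) + card (arms K Ks) + z"
      unfolding z_def using unstopped_count[OF assms(1)] unstopped_before_stop_time[OF M] by blast
    also have "\<dots> \<le> a + (1 - q) * M + z" using bound[of M] False by simp
    finally have "q * M \<le> a + z" by (simp add: algebra_simps)
    then have "2 * real M \<le> 2 * a / q + 2 / q * z" using q by (simp add: field_simps)
    then have "ennreal (2 * M) \<le> ennreal (2 * a / q + 2 / q * z)" by (intro ennreal_leI) simp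
    also have "\<dots> = ennreal (2 * a / q) + ennreal (2 / q) * of_nat z"
      unfolding ennreal_of_nat_eq_real_of_nat using q a
      by (subst ennreal_plus) (simp_all add: ennreal_mult[symmetric])
    also have "\<dots> \<le> ?b"
      unfolding z_def by (intro add_left_mono mult_left_mono card_invalid_le assms(1)) auto
    finally show ?thesis .
  qed simp
  show ?thesis
  proof (cases rule: stop_time_cases[of \<omega>])
    case 1
    \<comment> \<open>Without a stop, \<open>*\<close> holds for every \<open>M\<close>, so no real
      number can bound the right-hand side.\<close>
    have "?b = \<infinity>"
    proof (rule ccontr)
      assume "?b \<noteq> \<infinity>"
      then obtain r where r: "?b = ennreal r" "r \<ge> 0" by (cases ?b) auto
      obtain M :: nat where "r < M" using reals_Archimedean2 by blast
      then have "ennreal r < ennreal (2 * M)" using r by (simp add: ennreal_less_iff)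
      then show False using *[of M] 1 r(1) by simp
    qed
    then show ?thesis by simp
  next
    case (2 M)
    then show ?thesis using *[of M]
      by (simp add: ennreal_of_nat_eq_real_of_nat)
  qed
qed

section \<open>Expectation of the bad count and of the stopping time\<close>

lemma deviates_pred [measurable]: "Measurable.pred (table_space K Ks \<mu>) (\<lambda>Y. deviates Y m P n)"
  unfolding deviates_def by measurable

lemma measurable_bad_count [measurable]: "bad_count \<in> borel_measurable (table_space K Ks \<mu>)"
  unfolding bad_count_def by measurable

lemma prob_deviates_le:
  assumes "P \<in> arms K Ks" "n > 0"
  shows "emeasure (table_space K Ks \<mu>) {Y \<in> space (table_space K Ks \<mu>). deviates Y m P n}
    \<le> ennreal (2 * exp (- \<beta> (2 * m)))"
proof -
  interpret prob_space "table_space K Ks \<mu>" by (rule prob_space_table)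
  have "prob {Y \<in> space (table_space K Ks \<mu>). deviates Y m P n}
      \<le> 2 * exp (- 2 * real n * (sqrt (\<beta> (2 * m) / (2 * real n)))\<^sup>2)"
    unfolding deviates_def using mean_bounds[OF assms(1)] rate_nonneg assms
    by (intro Hoeffding_sample_mean(3)) auto
  also have "(sqrt (\<beta> (2 * m) / (2 * real n)))\<^sup>2 = \<beta> (2 * m) / (2 * real n)"
    using rate_nonneg by simp
  finally show ?thesis
    using assms(2) by (simp add: emeasure_eq_measure ennreal_leI)
qed

text \<open>At each \<open>m\<close> there are at most \<open>m\<close> numbers of draws per arm,
  each contributing the two-sided bound 2 exp (- \<beta>). The factor \<open>m\<close> from this
  union bound is why \<alpha> > 1 is asked for in \<open>summable_rate_tail\<close>.\<close>

lemma nn_integral_bad_count: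
  "(\<integral>\<^sup>+Y. bad_count Y \<partial>table_space K Ks \<mu>)
    \<le> (\<Sum>m. ennreal (2 * card (arms K Ks) * m * exp (- \<beta> (2 * m))))"
proof -
  let ?T = "table_space K Ks \<mu>"
  have "(\<integral>\<^sup>+Y. bad_count Y \<partial>?T)
      = (\<Sum>m. \<Sum>P\<in>arms K Ks. \<Sum>n\<in>{1..m}. \<integral>\<^sup>+Y. of_bool (deviates Y m P n) \<partial>?T)"
    unfolding bad_count_def by (simp add: nn_integral_suminf nn_integral_sum del: sum_of_bool_eq)
  also have "\<dots> \<le> (\<Sum>m. ennreal (2 * card (arms K Ks) * m * exp (- \<beta> (2 * m))))"
  proof (intro suminf_le)
    fix m
    have "(\<Sum>P\<in>arms K Ks. \<Sum>n\<in>{1..m}. \<integral>\<^sup>+Y. of_bool (deviates Y m P n) \<partial>?T)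
        \<le> (\<Sum>P\<in>arms K Ks. \<Sum>n\<in>{1..m}. ennreal (2 * exp (- \<beta> (2 * m))))"
    proof (intro sum_mono)
      fix P n assume "P \<in> arms K Ks" "n \<in> {1..m}"
      have "(\<integral>\<^sup>+Y. of_bool (deviates Y m P n) \<partial>?T)
          = (\<integral>\<^sup>+Y. indicator {Y \<in> space ?T. deviates Y m P n} Y \<partial>?T)"
        by (intro nn_integral_cong) (auto simp: indicator_def)
      also have "\<dots> = emeasure ?T {Y \<in> space ?T. deviates Y m P n}"
        by (intro nn_integral_indicator) measurable
      also have "\<dots> \<le> ennreal (2 * exp (- \<beta> (2 * m)))"
        using \<open>P \<in> arms K Ks\<close> \<open>n \<in> {1..m}\<close> by (intro prob_deviates_le) auto
      finally show "(\<integral>\<^sup>+Y. of_bool (deviates Y m P n) \<partial>?T) \<le> ennreal (2 * exp (- \<beta> (2 * m)))" .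
    qed
    also have "\<dots> = ennreal (2 * card (arms K Ks) * m * exp (- \<beta> (2 * m)))"
      by (simp add: ennreal_of_nat_eq_real_of_nat ennreal_mult[symmetric] mult_ac)
    finally show "(\<Sum>P\<in>arms K Ks. \<Sum>n\<in>{1..m}. \<integral>\<^sup>+Y. of_bool (deviates Y m P n) \<partial>?T)
        \<le> ennreal (2 * card (arms K Ks) * m * exp (- \<beta> (2 * m)))" .
  qed auto
  finally show ?thesis .
qed

lemma nn_integral_table:
  assumes [measurable]: "f \<in> borel_measurable (table_space K Ks \<mu>)"
  shows "(\<integral>\<^sup>+\<omega>. f (snd \<omega>) \<partial>bandit_space K Ks R \<mu>) = (\<integral>\<^sup>+Y. f Y \<partial>table_space K Ks \<mu>)"
proof -
  interpret R: prob_space R by (rule R)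
  interpret T: prob_space "table_space K Ks \<mu>" by (rule prob_space_table)
  have "(\<integral>\<^sup>+\<omega>. f (snd \<omega>) \<partial>bandit_space K Ks R \<mu>)
      = (\<integral>\<^sup>+u. \<integral>\<^sup>+Y. f (snd (u, Y)) \<partial>table_space K Ks \<mu> \<partial>R)"
    unfolding bandit_space_def by (rule T.nn_integral_fst[symmetric]) measurable
  then show ?thesis by (simp add: R.emeasure_space_1)
qed

lemma nn_integral_stop_time_le:
  assumes q: "q > 0" and a: "a \<ge> 0"
    and bound: "\<And>M. M \<ge> 1 \<Longrightarrow>
      2 * \<beta> (2 * M) * (\<Sum>P\<in>arms K Ks. 1 / gap_sq \<mu> P) + card (arms K Ks) \<le> a + (1 - q) * M"
  shows "(\<integral>\<^sup>+\<omega>. ennreal_of_enat (stop_time K Ks \<beta> A \<omega>) \<partial>bandit_space K Ks R \<mu>)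
    \<le> ennreal (2 * a / q) + ennreal (2 / q) * (\<Sum>m. ennreal (2 * card (arms K Ks) * m * exp (- \<beta> (2 * m))))"
proof -
  interpret T: prob_space "table_space K Ks \<mu>" by (rule prob_space_table)
  have "(\<integral>\<^sup>+\<omega>. ennreal_of_enat (stop_time K Ks \<beta> A \<omega>) \<partial>bandit_space K Ks R \<mu>)
      \<le> (\<integral>\<^sup>+\<omega>. ennreal (2 * a / q) + ennreal (2 / q) * bad_count (snd \<omega>) \<partial>bandit_space K Ks R \<mu>)"
    using ennreal_stop_time_le[OF _ q a bound]
    by (intro nn_integral_mono) (auto simp: bandit_space_def space_pair_measure)
  also have "\<dots> = (\<integral>\<^sup>+Y. ennreal (2 * a / q) + ennreal (2 / q) * bad_count Y \<partial>table_space K Ks \<mu>)"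
    by (intro nn_integral_table[of "\<lambda>Y. ennreal (2 * a / q) + ennreal (2 / q) * bad_count Y"]) measurable
  also have "\<dots> = ennreal (2 * a / q) + ennreal (2 / q) * (\<integral>\<^sup>+Y. bad_count Y \<partial>table_space K Ks \<mu>)"
    by (simp add: nn_integral_add nn_integral_cmult T.emeasure_space_1)
  also have "\<dots> \<le> ennreal (2 * a / q) + ennreal (2 / q) *
      (\<Sum>m. ennreal (2 * card (arms K Ks) * m * exp (- \<beta> (2 * m))))"
    by (intro add_left_mono mult_left_mono nn_integral_bad_count) auto
  finally show ?thesis .
qed

lemma AE_stop_time_finite:
  assumes "(\<integral>\<^sup>+\<omega>. ennreal_of_enat (stop_time K Ks \<beta> A \<omega>) \<partial>bandit_space K Ks R \<mu>) < \<infinity>"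
  shows "AE \<omega> in bandit_space K Ks R \<mu>. stop_time K Ks \<beta> A \<omega> < \<infinity>"
proof -
  have "(\<lambda>\<omega>. ennreal_of_enat (stop_time K Ks \<beta> A \<omega>)) \<in> borel_measurable (bandit_space K Ks R \<mu>)"
    by (rule measurable_compose[OF measurable_stop_time[OF mlucb]]) simp
  then have "AE \<omega> in bandit_space K Ks R \<mu>. ennreal_of_enat (stop_time K Ks \<beta> A \<omega>) \<noteq> \<infinity>"
    using assms by (intro nn_integral_noteq_infinite) auto
  then show ?thesis
  proof eventually_elim
    case (elim \<omega>)
    then have "stop_time K Ks \<beta> A \<omega> \<noteq> \<infinity>"
      by (metis ennreal_of_enat_infty infinity_ennreal_def)
    then show ?case unfolding enat_ord_simps(4) .
  qed
qed

end

subsection \<open>The exploration rate\<close>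

lemma exp_minus_expl_rate:
  assumes "C > 0" "0 < \<delta>" "t > 0"
  shows "exp (- expl_rate C \<alpha> \<delta> t) = \<delta> / (C * real t powr (1 + \<alpha>))"
  using assms by (simp add: expl_rate_def exp_minus)

lemma expl_rate_eq:
  assumes "C > 0" "0 < \<delta>" "t > 0"
  shows "expl_rate C \<alpha> \<delta> t = ln C + (1 + \<alpha>) * ln (real t) + ln (1 / \<delta>)"
  using assms by (simp add: expl_rate_def ln_div ln_mult ln_powr)

lemma mlucb_run_expl_rate:
  assumes "K \<ge> 2" "\<And>i. i \<in> {1..K} \<Longrightarrow> Ks i \<ge> 1" "\<alpha> > 1" "C > 0" "0 < \<delta>"
    and nonneg: "\<And>t. even t \<Longrightarrow> t > 0 \<Longrightarrow> 0 \<le> expl_rate C \<alpha> \<delta> t"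
    and "prob_space R" "is_mlucb K Ks (expl_rate C \<alpha> \<delta>) R A"
    and "bandit_instance K Ks \<mu>" "\<mu> (1, 1) > \<mu> (2, 1)"
  shows "mlucb_run K Ks \<mu> (expl_rate C \<alpha> \<delta>) R A"
proof (rule mlucb_run.intro)
  \<comment> \<open>At time 0 the argument of the logarithm is 0, and \<open>ln 0 = 0\<close> by
    convention.\<close>
  show "0 \<le> expl_rate C \<alpha> \<delta> 0" by (simp add: expl_rate_def)
  show "expl_rate C \<alpha> \<delta> (2 * m) \<le> expl_rate C \<alpha> \<delta> (2 * n)" if "m \<le> n" for m n
  proof (cases "m = 0")
    case True
    then show ?thesis using nonneg[of "2 * n"] by (cases "n = 0") (auto simp: expl_rate_def)
  next
    case False
    then have "ln (real (2 * m)) \<le> ln (real (2 * n))" using that by simp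
    then have "(1 + \<alpha>) * ln (real (2 * m)) \<le> (1 + \<alpha>) * ln (real (2 * n))"
      using \<open>\<alpha> > 1\<close> by (intro mult_left_mono) auto
    then show ?thesis using False that assms(4,5) by (simp only: expl_rate_eq)
  qed
qed (fact assms)+

lemma H_star_eq: "H_star K Ks \<mu> = (\<Sum>P\<in>arms K Ks. 1 / gap_sq \<mu> P)"
  by (simp add: H_star_def gap_sq_def midpoint_def case_prod_unfold)

lemma summable_rate_tail:
  assumes "\<alpha> > (1 :: real)"
  shows "summable (\<lambda>m. real m / real (2 * m) powr (1 + \<alpha>))"
proof (rule summable_comparison_test')
  show "summable (\<lambda>m. real m powr (- \<alpha>))"
    using assms by (simp add: summable_real_powr_iff)
  fix m :: nat assume "m \<ge> 1"
  then have "real m / real (2 * m) powr (1 + \<alpha>) \<le> real m / real m powr (1 + \<alpha>)"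
    using assms by (intro divide_left_mono powr_mono2) auto
  also have "\<dots> = real m powr (- \<alpha>)"
    using \<open>m \<ge> 1\<close> by (simp add: powr_add powr_minus field_simps)
  finally show "norm (real m / real (2 * m) powr (1 + \<alpha>)) \<le> real m powr (- \<alpha>)" by simp
qed

text \<open>The logarithm of the time is absorbed into a small multiple of \<open>M\<close>. With q
  = 4 H / x, the leading part 2 H ln (1/\<delta>) of \<open>a\<close> becomes x ln (1/\<delta>)
  after multiplication by 2 / q. The constant \<open>c\<close> is uniform in \<delta>, as the limit
  requires.\<close>

lemma mlucb_expected_stop_time:
  fixes R :: "'s measure" and A :: "real \<Rightarrow> 's mlucb_choice"
  assumes K: "K \<ge> 2" "\<And>i. i \<in> {1..K} \<Longrightarrow> Ks i \<ge> 1" and \<alpha>: "\<alpha> > 1" and C: "C > 0"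
    and nonneg: "\<And>\<delta> t. 0 < \<delta> \<Longrightarrow> \<delta> < 1 \<Longrightarrow> even t \<Longrightarrow> t > 0 \<Longrightarrow> 0 \<le> expl_rate C \<alpha> \<delta> t"
    and R: "prob_space R"
    and A: "\<And>\<delta>. 0 < \<delta> \<Longrightarrow> \<delta> < 1 \<Longrightarrow> is_mlucb K Ks (expl_rate C \<alpha> \<delta>) R (A \<delta>)"
    and inst: "bandit_instance K Ks \<mu>" "\<mu> (1, 1) > \<mu> (2, 1)"
    and x: "x > 4 * H_star K Ks \<mu>"
  shows "\<exists>c\<ge>0. \<forall>\<delta>. 0 < \<delta> \<and> \<delta> < 1 \<longrightarrow>
    (\<integral>\<^sup>+\<omega>. ennreal_of_enat (stop_time K Ks (expl_rate C \<alpha> \<delta>) (A \<delta>) \<omega>) \<partial>bandit_space K Ks R \<mu>)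
      \<le> ennreal (x * ln (1 / \<delta>) + c)"
proof -
  define H where "H = H_star K Ks \<mu>"
  define N where "N = real (card (arms K Ks))"
  \<comment> \<open>Any admissible confidence level will do: the run serves only to obtain
    positivity of \<open>gap_sq\<close>, which does not involve \<delta>.\<close>
  have "mlucb_run K Ks \<mu> (expl_rate C \<alpha> (1/2)) R (A (1/2))"
    using nonneg[of "1/2"] A[of "1/2"] by (intro mlucb_run_expl_rate K \<alpha> C R inst) auto
  then interpret half: mlucb_run K Ks \<mu> "expl_rate C \<alpha> (1/2)" R "A (1/2)" .
  have "H > 0"
  proof -
    have "(1, 1) \<in> arms K Ks" using K(1) K(2)[of 1] by (auto simp: arms_def)
    then show ?thesis unfolding H_def H_star_eq
      using half.gap_sq_pos by (intro sum_pos) auto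
  qed
  define q where "q = 4 * H / x"
  have q: "0 < q" "q < 1" using x \<open>H > 0\<close> by (auto simp: q_def H_def field_simps)
  \<comment> \<open>Chosen so that 2 H (1 + \<alpha>) \<eta> = 1 - q; the logarithm is bounded
    through ln y \<le> y - 1 at y = \<eta> M.\<close>
  define \<eta> where "\<eta> = (1 - q) / (2 * H * (1 + \<alpha>))"
  have \<eta>: "\<eta> > 0" using q \<open>H > 0\<close> \<alpha> by (simp add: \<eta>_def)
  define c0 where "c0 = \<bar>2 * H * (ln C + (1 + \<alpha>) * ln (2 / \<eta>)) + N\<bar>"
  define B where "B = 2 * N / C * (\<Sum>m. real m / real (2 * m) powr (1 + \<alpha>))"
  have "(\<Sum>m. real m / real (2 * m) powr (1 + \<alpha>)) \<ge> 0"
    by (rule suminf_nonneg[OF summable_rate_tail[OF \<alpha>]]) simp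
  then have B: "B \<ge> 0" unfolding B_def N_def using C by simp
  show ?thesis
  proof (intro exI[of _ "2 * c0 / q + 2 / q * B"] conjI allI impI)
    show "0 \<le> 2 * c0 / q + 2 / q * B" using q B by (simp add: c0_def)
    fix \<delta> :: real assume \<delta>: "0 < \<delta> \<and> \<delta> < 1"
    have run: "mlucb_run K Ks \<mu> (expl_rate C \<alpha> \<delta>) R (A \<delta>)"
      using nonneg A \<delta> by (intro mlucb_run_expl_rate K \<alpha> C R inst) auto
    define a where "a = 2 * H * ln (1 / \<delta>) + c0"
    have a: "a \<ge> 0" using \<delta> \<open>H > 0\<close> by (simp add: a_def c0_def)
    have bound: "2 * expl_rate C \<alpha> \<delta> (2 * M) * (\<Sum>P\<in>arms K Ks. 1 / gap_sq \<mu> P) + card (arms K Ks)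
        \<le> a + (1 - q) * M" if "M \<ge> 1" for M :: nat
    proof -
      have "ln (real (2 * M)) = ln (\<eta> * M) + ln (2 / \<eta>)"
        using that \<eta> by (subst ln_mult_pos[symmetric]) auto
      also have "ln (\<eta> * M) \<le> \<eta> * M" using that \<eta> by (intro order.trans[OF ln_le_minus_one]) auto
      finally have ln: "ln (real (2 * M)) \<le> \<eta> * M + ln (2 / \<eta>)" by simp
      have "2 * expl_rate C \<alpha> \<delta> (2 * M) * H + N
          = 2 * H * ln (1 / \<delta>) + 2 * H * ln C + N + 2 * H * (1 + \<alpha>) * ln (real (2 * M))"
        using that C \<delta> by (simp add: expl_rate_eq algebra_simps del: of_nat_mult)
      also have "\<dots> \<le> 2 * H * ln (1 / \<delta>) + 2 * H * ln C + N + 2 * H * (1 + \<alpha>) * (\<eta> * M + ln (2 / \<eta>))"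
        using ln \<open>H > 0\<close> \<alpha> by (intro add_left_mono mult_left_mono) auto
      also have "\<dots> = 2 * H * ln (1 / \<delta>) + (2 * H * (ln C + (1 + \<alpha>) * ln (2 / \<eta>)) + N)
          + (2 * H * (1 + \<alpha>) * \<eta>) * M" by (simp add: algebra_simps)
      also have "2 * H * (1 + \<alpha>) * \<eta> = 1 - q" using \<open>H > 0\<close> \<alpha> by (simp add: \<eta>_def)
      also have "2 * H * ln (1 / \<delta>) + (2 * H * (ln C + (1 + \<alpha>) * ln (2 / \<eta>)) + N) + (1 - q) * M \<le> a + (1 - q) * M"
        unfolding a_def c0_def by simp
      finally show ?thesis by (simp add: H_def H_star_eq N_def)
    qed
    have "(\<Sum>m. ennreal (2 * card (arms K Ks) * m * exp (- expl_rate C \<alpha> \<delta> (2 * m)))) \<le> ennreal B"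
    proof -
      \<comment> \<open>For m > 0 the term carries a factor \<delta>, which is bounded by 1 to make
        \<open>B\<close> independent of \<delta>.\<close>
      have le: "2 * card (arms K Ks) * m * exp (- expl_rate C \<alpha> \<delta> (2 * m))
          \<le> 2 * N / C * (real m / real (2 * m) powr (1 + \<alpha>))" for m :: nat
      proof (cases "m = 0")
        case False
        have "2 * card (arms K Ks) * m * exp (- expl_rate C \<alpha> \<delta> (2 * m))
            = \<delta> * (2 * N / C * (real m / real (2 * m) powr (1 + \<alpha>)))"
          using False C \<delta> by (simp add: exp_minus_expl_rate N_def)
        also have "\<dots> \<le> 1 * (2 * N / C * (real m / real (2 * m) powr (1 + \<alpha>)))"
          using \<delta> C by (intro mult_right_mono) (auto simp: N_def)
        finally show ?thesis by simp
      qed simp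
      have "(\<Sum>m. ennreal (2 * card (arms K Ks) * m * exp (- expl_rate C \<alpha> \<delta> (2 * m))))
          \<le> (\<Sum>m. ennreal (2 * N / C * (real m / real (2 * m) powr (1 + \<alpha>))))"
        by (intro suminf_le ennreal_leI le) auto
      also have "\<dots> = ennreal (\<Sum>m. 2 * N / C * (real m / real (2 * m) powr (1 + \<alpha>)))"
        using C summable_rate_tail[OF \<alpha>] by (intro suminf_ennreal2 summable_mult) (auto simp: N_def)
      also have "(\<Sum>m. 2 * N / C * (real m / real (2 * m) powr (1 + \<alpha>))) = B"
        unfolding B_def by (rule suminf_mult[OF summable_rate_tail[OF \<alpha>]])
      finally show ?thesis .
    qed
    then have "ennreal (2 * a / q) + ennreal (2 / q) *
        (\<Sum>m. ennreal (2 * card (arms K Ks) * m * exp (- expl_rate C \<alpha> \<delta> (2 * m))))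
        \<le> ennreal (2 * a / q) + ennreal (2 / q) * ennreal B"
      by (intro add_left_mono mult_left_mono) auto
    also have "\<dots> = ennreal (2 * a / q + 2 / q * B)"
      using q a B by (subst ennreal_plus) (simp_all add: ennreal_mult[symmetric])
    also have "2 * a / q + 2 / q * B = x * ln (1 / \<delta>) + (2 * c0 / q + 2 / q * B)"
    proof -
      have "4 * H / q = x" using \<open>H > 0\<close> q by (simp add: q_def)
      then have "2 * a / q = x * ln (1 / \<delta>) + 2 * c0 / q"
        unfolding a_def by (auto simp: add_divide_distrib ring_distribs)
      then show ?thesis by simp
    qed
    finally show "(\<integral>\<^sup>+\<omega>. ennreal_of_enat (stop_time K Ks (expl_rate C \<alpha> \<delta>) (A \<delta>) \<omega>) \<partial>bandit_space K Ks R \<mu>)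
      \<le> ennreal (x * ln (1 / \<delta>) + (2 * c0 / q + 2 / q * B))"
      using mlucb_run.nn_integral_stop_time_le[OF run q(1) a bound] by (rule order_trans[rotated])
  qed
qed

subsection \<open>Probability of a wrong recommendation\<close>

context mlucb_run
begin

text \<open>The harmful direction of deviation: action 1 looks too bad or another action too good.
  Being one-sided, it avoids the factor 2 of the two-sided Hoeffding bound.\<close>

definition deviates_to_error :: "(arm \<times> nat \<Rightarrow> bool) \<Rightarrow> real \<Rightarrow> arm \<Rightarrow> nat \<Rightarrow> bool" where
  "deviates_to_error Y r P n \<longleftrightarrow>
     (if fst P = 1 then sample_mean Y P n \<le> \<mu> P - sqrt (r / (2 * real n))
      else sample_mean Y P n \<ge> \<mu> P + sqrt (r / (2 * real n)))"

text \<open>An arm with \<open>n\<close> draws is relevant only at pairs \<open>m \<ge> n\<close>,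
  and only \<open>m \<ge> m0\<close> is considered. The rate is smallest at the first such
  \<open>m\<close>, so a single event per arm and per \<open>n\<close> covers all later times.
  \<open>Suc n\<close> makes the count start at 1.\<close>

definition deviation_event :: "nat \<Rightarrow> (arm \<times> nat \<Rightarrow> bool) set" where
  "deviation_event m0 = {Y \<in> space (table_space K Ks \<mu>).
     \<exists>P\<in>arms K Ks. \<exists>n. deviates_to_error Y (\<beta> (2 * max (Suc n) m0)) P (Suc n)}"

lemma deviates_to_error_antimono:
  assumes "r' \<le> r" "deviates_to_error Y r P n"
  shows "deviates_to_error Y r' P n"
proof -
  have le: "sqrt (r' / (2 * real n)) \<le> sqrt (r / (2 * real n))"
    using assms(1) by (intro real_sqrt_le_mono divide_right_mono) auto
  show ?thesis
  proof (cases "fst P = 1")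
    case True
    then have "sample_mean Y P n \<le> \<mu> P - sqrt (r / (2 * real n))"
      using assms(2) by (simp add: deviates_to_error_def)
    with le have "sample_mean Y P n \<le> \<mu> P - sqrt (r' / (2 * real n))" by linarith
    with True show ?thesis by (simp add: deviates_to_error_def)
  next
    case False
    then have "sample_mean Y P n \<ge> \<mu> P + sqrt (r / (2 * real n))"
      using assms(2) by (simp add: deviates_to_error_def)
    with le have "sample_mean Y P n \<ge> \<mu> P + sqrt (r' / (2 * real n))" by linarith
    with False show ?thesis by (simp add: deviates_to_error_def)
  qed
qed

lemma deviates_to_error_pred [measurable]:
  "Measurable.pred (table_space K Ks \<mu>) (\<lambda>Y. deviates_to_error Y r P n)"
  unfolding deviates_to_error_def by (cases "fst P = 1"; simp)

lemma sets_deviation_event [measurable]: "deviation_event m0 \<in> sets (table_space K Ks \<mu>)"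
proof -
  have [measurable]: "Measurable.pred (table_space K Ks \<mu>)
    (\<lambda>Y. \<exists>P\<in>arms K Ks. \<exists>n. deviates_to_error Y (\<beta> (2 * max (Suc n) m0)) P (Suc n))"
    by (intro pred_intros_finite pred_intros_countable) auto
  show ?thesis unfolding deviation_event_def by measurable
qed

lemma prob_deviates_to_error:
  assumes "P \<in> arms K Ks" "n > 0" "r \<ge> 0"
  shows "measure (table_space K Ks \<mu>) {Y \<in> space (table_space K Ks \<mu>). deviates_to_error Y r P n}
    \<le> exp (- r)"
proof -
  interpret prob_space "table_space K Ks \<mu>" by (rule prob_space_table)
  define w where "w = sqrt (r / (2 * real n))"
  have w: "w \<ge> 0" "2 * real n * w\<^sup>2 = r" using assms by (simp_all add: w_def)
  have "prob {Y \<in> space (table_space K Ks \<mu>). deviates_to_error Y r P n} \<le> exp (- 2 * real n * w\<^sup>2)"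
    using Hoeffding_sample_mean(1,2)[where \<mu> = \<mu>, OF assms(1) _ _ assms(2) w(1)] mean_bounds[OF assms(1)]
    by (cases "fst P = 1") (simp_all add: deviates_to_error_def w_def)
  then show ?thesis using w(2) by simp
qed

lemma prob_deviation_event:
  fixes g :: "nat \<Rightarrow> real"
  assumes g: "summable g" and le: "\<And>k. exp (- \<beta> (2 * max (Suc k) m0)) \<le> g k"
  shows "measure (table_space K Ks \<mu>) (deviation_event m0) \<le> card (arms K Ks) * (\<Sum>k. g k)"
proof -
  interpret prob_space "table_space K Ks \<mu>" by (rule prob_space_table)
  define E where "E P k = {Y \<in> space (table_space K Ks \<mu>).
    deviates_to_error Y (\<beta> (2 * max (Suc k) m0)) P (Suc k)}" for P k
  have [measurable]: "E P k \<in> events" for P k unfolding E_def by measurable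
  have E_le: "prob (E P k) \<le> g k" if "P \<in> arms K Ks" for P k
    unfolding E_def using prob_deviates_to_error[OF that, of "Suc k" "\<beta> (2 * max (Suc k) m0)"]
      rate_nonneg le[of k] by (intro order.trans[OF _ le]) auto
  have "prob (deviation_event m0) = prob (\<Union>P\<in>arms K Ks. \<Union>k. E P k)"
    by (intro arg_cong[where f = prob]) (auto simp: deviation_event_def E_def)
  also have "\<dots> \<le> (\<Sum>P\<in>arms K Ks. prob (\<Union>k. E P k))"
    by (intro finite_measure_subadditive_finite) auto
  also have "\<dots> \<le> (\<Sum>P\<in>arms K Ks. \<Sum>k. g k)"
  proof (intro sum_mono)
    fix P assume P: "P \<in> arms K Ks"
    have s: "summable (\<lambda>k. prob (E P k))"
      by (rule summable_comparison_test'[OF g, of 0]) (use E_le[OF P] in auto)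
    have "prob (\<Union>k. E P k) \<le> (\<Sum>k. prob (E P k))"
      using s by (intro finite_measure_subadditive_countably) auto
    also have "\<dots> \<le> (\<Sum>k. g k)" by (intro suminf_le E_le[OF P] s g)
    finally show "prob (\<Union>k. E P k) \<le> (\<Sum>k. g k)" .
  qed
  finally show ?thesis by simp
qed

text \<open>\<open>P\<close> is the first arm of the recommended action and \<open>Q\<close> an arm of the optimal one.\<close>
lemma wrong_leader:
  assumes u: "u \<in> space R" and stop: "stops (hist u Y m)"
    and wrong: "\<mu> (leader A u (hist u Y m), 1) < \<mu> (1, 1)"
  obtains P Q n1 n2 where "P \<in> arms K Ks" "Q \<in> arms K Ks" "fst P \<noteq> 1" "fst Q = 1" "\<mu> P \<le> \<mu> Q"
    "n1 = pulls (hist u Y m) P" "n2 = pulls (hist u Y m) Q" "n1 \<in> {1..m}" "n2 \<in> {1..m}"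
    "sample_mean Y Q n2 + sqrt (\<beta> (2 * m) / (2 * real n2))
       < sample_mean Y P n1 - sqrt (\<beta> (2 * m) / (2 * real n1))"
proof -
  define h where "h = hist u Y m"
  define i where "i = leader A u h"
  interpret mlucb_decision K Ks \<mu> \<beta> "init_mean A" h "leader A u h" "cand A u h" "challenger A u h"
    unfolding h_def by (rule decision[OF u])
  have i: "i \<in> {1..K}" "i \<noteq> 1" using lead_in wrong by (auto simp: i_def h_def)
  have 1: "1 \<in> {1..K}" using K by simp
  obtain j where j: "j \<in> {1..Ks 1}" "U (1, j) < L (i, 1)"
    using stop_conditionD[OF stop[folded h_def]] i(2) 1 Ks[OF i(1)] unfolding i_def by fastforce
  define P Q where "P = (i, 1::nat)" and "Q = (1::nat, j)"
  define n1 n2 where "n1 = pulls h P" and "n2 = pulls h Q"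
  have "U Q \<noteq> \<infinity>" "L P \<noteq> - \<infinity>" using j by (auto simp: P_def Q_def)
  then have n: "n1 > 0" "n2 > 0"
    by (auto simp: n1_def n2_def upper_conf_def lower_conf_def split: if_splits)
  show ?thesis
  proof (rule that)
    show "P \<in> arms K Ks" "Q \<in> arms K Ks" "fst P \<noteq> 1" "fst Q = 1"
      using i Ks[OF i(1)] j(1) K by (auto simp: P_def Q_def arms_def)
    have "\<mu> (1, 1) \<le> \<mu> (1, j)" by (rule mean_mono[OF 1 j(1)])
    then show "\<mu> P \<le> \<mu> Q" using wrong by (simp add: P_def Q_def i_def h_def)
    show "n1 = pulls (hist u Y m) P" "n2 = pulls (hist u Y m) Q"
      by (simp_all add: n1_def n2_def h_def)
    show "n1 \<in> {1..m}" "n2 \<in> {1..m}"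
      using n pulls_le[OF u, of Y m] by (auto simp: n1_def n2_def h_def)
    have "emp_mean (init_mean A) h P = sample_mean Y P n1"
      using n(1) unfolding n1_def h_def by (rule emp_mean_bandit_history)
    moreover have "emp_mean (init_mean A) h Q = sample_mean Y Q n2"
      using n(2) unfolding n2_def h_def by (rule emp_mean_bandit_history)
    moreover have "U Q < L P" "length h = 2 * m" using j by (auto simp: P_def Q_def h_def)
    ultimately show "sample_mean Y Q n2 + sqrt (\<beta> (2 * m) / (2 * real n2))
       < sample_mean Y P n1 - sqrt (\<beta> (2 * m) / (2 * real n1))"
      using n by (simp add: upper_conf_def lower_conf_def n1_def n2_def)
  qed
qed

text \<open>Sample means lie in [0, 1] and both half-widths are at least
  \<open>sqrt (\<beta> (2 * m) / (2 * m))\<close>, so separated intervals force \<beta> < m / 2.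
  Since \<open>\<mu> P \<le> \<mu> Q\<close>, at least one of the two sample means deviates in its
  harmful direction. For \<open>m = 1\<close> each of the two arms has one draw, so the rewards must
  be 1 and 0.\<close>

lemma wrong_leader_deviation:
  assumes u: "u \<in> space R" and stop: "stops (hist u Y m)"
    and wrong: "\<mu> (leader A u (hist u Y m), 1) < \<mu> (1, 1)"
  shows "\<beta> (2 * m) < real m / 2" "m \<ge> 1"
    and "Y \<in> space (table_space K Ks \<mu>) \<Longrightarrow> m0 \<le> m \<Longrightarrow> Y \<in> deviation_event m0"
    and "m = 1 \<Longrightarrow> \<exists>P\<in>drawn u []. \<exists>Q\<in>drawn u []. P \<in> arms K Ks \<and> Q \<in> arms K Ks \<and>
      fst P \<noteq> 1 \<and> fst Q = 1 \<and> \<mu> P \<le> \<mu> Q \<and> Y (P, 0) \<and> \<not> Y (Q, 0)"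
proof -
  obtain P Q n1 n2 where PQ: "P \<in> arms K Ks" "Q \<in> arms K Ks" "fst P \<noteq> 1" "fst Q = 1" "\<mu> P \<le> \<mu> Q"
    and n_eq: "n1 = pulls (hist u Y m) P" "n2 = pulls (hist u Y m) Q"
    and n: "n1 \<in> {1..m}" "n2 \<in> {1..m}"
    and less: "sample_mean Y Q n2 + sqrt (\<beta> (2 * m) / (2 * real n2))
       < sample_mean Y P n1 - sqrt (\<beta> (2 * m) / (2 * real n1))"
    using wrong_leader[OF assms] by metis
  show m: "m \<ge> 1" using n by simp
  have sqrt_le: "sqrt (\<beta> (2 * m) / (2 * real m)) \<le> sqrt (\<beta> (2 * m) / (2 * real k))"
    if "k \<in> {1..m}" for k
    using that rate_nonneg by (intro real_sqrt_le_mono divide_left_mono) auto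
  have "2 * sqrt (\<beta> (2 * m) / (2 * real m)) < 1"
    using less sqrt_le[OF n(1)] sqrt_le[OF n(2)] sample_mean_bounds(1)[of Y Q n2]
      sample_mean_bounds(2)[of Y P n1] by linarith
  moreover have "sqrt (1 / 4) = 1 / (2 :: real)" by (simp add: real_sqrt_divide)
  ultimately have "sqrt (\<beta> (2 * m) / (2 * real m)) < sqrt (1 / 4)" by linarith
  then have "\<beta> (2 * m) / (2 * real m) < 1 / 4" by simp
  then show "\<beta> (2 * m) < real m / 2" using m by (simp add: field_simps)
  show "Y \<in> deviation_event m0" if Y: "Y \<in> space (table_space K Ks \<mu>)" and "m0 \<le> m"
  proof -
    have "deviates_to_error Y (\<beta> (2 * m)) P n1 \<or> deviates_to_error Y (\<beta> (2 * m)) Q n2"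
      using less PQ(3-5) by (auto simp: deviates_to_error_def)
    then obtain P' k where k: "P' \<in> arms K Ks" "k \<in> {1..m}" "deviates_to_error Y (\<beta> (2 * m)) P' k"
      using PQ n by blast
    have "\<beta> (2 * max k m0) \<le> \<beta> (2 * m)" using k(2) \<open>m0 \<le> m\<close> by (intro rate_mono) auto
    from deviates_to_error_antimono[OF this k(3)] Y k(1,2) show ?thesis
      unfolding deviation_event_def by (auto intro!: bexI[of _ P'] exI[of _ "k - 1"])
  qed
  show "\<exists>P\<in>drawn u []. \<exists>Q\<in>drawn u []. P \<in> arms K Ks \<and> Q \<in> arms K Ks \<and>
      fst P \<noteq> 1 \<and> fst Q = 1 \<and> \<mu> P \<le> \<mu> Q \<and> Y (P, 0) \<and> \<not> Y (Q, 0)" if "m = 1"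
  proof -
    have n1: "n1 = 1" "n2 = 1" using n that by auto
    have pulls_m: "pulls (hist u Y m) X = of_bool (X \<in> drawn u [])" for X
      using pulls_Suc[OF u, of Y 0 X] that by simp
    have "P \<in> drawn u []" "Q \<in> drawn u []"
      using n1 unfolding n_eq pulls_m by (metis of_bool_eq(1) zero_neq_one)+
    moreover have "sample_mean Y Q 1 < sample_mean Y P 1"
    proof -
      have "sqrt (\<beta> (2 * m) / (2 * real 1)) \<ge> 0" using rate_nonneg[of m] by simp
      with less[unfolded n1] show ?thesis by linarith
    qed
    then have "Y (P, 0)" "\<not> Y (Q, 0)"
      by (auto simp: sample_mean_def split: if_splits)
    ultimately show ?thesis using PQ by blast
  qed
qed

section \<open>Events of the reward table that contain all wrong stops\<close>

lemma prob_reward: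
  assumes "P \<in> arms K Ks"
  shows "measure (table_space K Ks \<mu>) {Y \<in> space (table_space K Ks \<mu>). Y (P, n)} = \<mu> P"
    and "measure (table_space K Ks \<mu>) {Y \<in> space (table_space K Ks \<mu>). \<not> Y (P, n)} = 1 - \<mu> P"
proof -
  interpret prob_space "table_space K Ks \<mu>" by (rule prob_space_table)
  have [measurable]: "{Y \<in> space (table_space K Ks \<mu>). Y (P, n)} \<in> events" by measurable
  have "\<mu> P = expectation (\<lambda>Y. of_bool (Y (P, n)))"
    using expectation_table[where \<mu> = \<mu>, OF assms] mean_bounds[OF assms] by simp
  also have "\<dots> = expectation (indicator {Y \<in> space (table_space K Ks \<mu>). Y (P, n)})"
    by (intro Bochner_Integration.integral_cong) (auto simp: indicator_def)
  also have "\<dots> = prob {Y \<in> space (table_space K Ks \<mu>). Y (P, n)}"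
    by (subst Bochner_Integration.integral_indicator) (auto simp: Int_absorb2)
  finally show 1: "prob {Y \<in> space (table_space K Ks \<mu>). Y (P, n)} = \<mu> P" by simp
  have "{Y \<in> space (table_space K Ks \<mu>). \<not> Y (P, n)} =
      space (table_space K Ks \<mu>) - {Y \<in> space (table_space K Ks \<mu>). Y (P, n)}" by auto
  then show "prob {Y \<in> space (table_space K Ks \<mu>). \<not> Y (P, n)} = 1 - \<mu> P"
    using 1 by (simp only: prob_compl[OF \<open>_ \<in> events\<close>])
qed

text \<open>A wrong stop after two rounds needs the reward 1 from the worse of the two drawn arms and the
  reward 0 from the better one; one of these has probability at most one half.\<close>
lemma first_rounds_event:
  assumes u: "u \<in> space R"
  obtains E where "E \<in> sets (table_space K Ks \<mu>)" "measure (table_space K Ks \<mu>) E \<le> 1 / 2"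
    "\<And>Y P Q. Y \<in> space (table_space K Ks \<mu>) \<Longrightarrow> P \<in> drawn u [] \<Longrightarrow> Q \<in> drawn u [] \<Longrightarrow>
       P \<in> arms K Ks \<Longrightarrow> Q \<in> arms K Ks \<Longrightarrow>
       fst P \<noteq> 1 \<Longrightarrow> fst Q = 1 \<Longrightarrow> \<mu> P \<le> \<mu> Q \<Longrightarrow> Y (P, 0) \<Longrightarrow> \<not> Y (Q, 0) \<Longrightarrow> Y \<in> E"
proof (cases "\<exists>P\<in>drawn u []. \<exists>Q\<in>drawn u []. P \<in> arms K Ks \<and> Q \<in> arms K Ks \<and>
    fst P \<noteq> 1 \<and> fst Q = 1 \<and> \<mu> P \<le> \<mu> Q")
  case False
  then show ?thesis using that[of "{}"] by auto
next
  case True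
  then obtain P Q where PQ: "P \<in> drawn u []" "Q \<in> drawn u []" "P \<in> arms K Ks" "Q \<in> arms K Ks"
    "fst P \<noteq> 1" "fst Q = 1" "\<mu> P \<le> \<mu> Q" by blast
  \<comment> \<open>The first pair is drawn from the empty history, so it is fixed by the seed and
    consists of two arms only; one event for this pair suffices.\<close>
  have unique: "P' = P" "Q' = Q" if "P' \<in> drawn u []" "Q' \<in> drawn u []" "fst P' \<noteq> 1" "fst Q' = 1" for P' Q'
    using that PQ unfolding drawn_def by auto
  show ?thesis
  proof (cases "\<mu> P \<le> 1 / 2")
    case True
    show ?thesis
      by (rule that[of "{Y \<in> space (table_space K Ks \<mu>). Y (P, 0)}"])
        (use prob_reward(1)[OF PQ(3)] True unique in auto)
  next
    case False
    show ?thesis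
      by (rule that[of "{Y \<in> space (table_space K Ks \<mu>). \<not> Y (Q, 0)}"])
        (use prob_reward(2)[OF PQ(4)] PQ(7) False unique in auto)
  qed
qed

text \<open>Wrong stops with \<open>m \<ge> m0\<close> lie in the deviation event, and those with
  \<open>2 \<le> m < m0\<close> are impossible because the rate is too large. For
  \<open>m = 1 < m0\<close>, either the rate at time 2 is at least 1/2, which excludes them, or the
  event of \<open>first_rounds_event\<close> is added.\<close>

lemma wrong_leader_event:
  assumes u: "u \<in> space R"
    and no_stop: "\<And>m. 2 \<le> m \<Longrightarrow> m < m0 \<Longrightarrow> real m / 2 \<le> \<beta> (2 * m)"
    and prob: "measure (table_space K Ks \<mu>) (deviation_event m0) \<le> \<epsilon>"
    and first: "m0 \<le> 1 \<or> 1 / 2 \<le> \<beta> 2 \<or> measure (table_space K Ks \<mu>) (deviation_event m0) + 1 / 2 \<le> \<epsilon>"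
  obtains E where "E \<in> sets (table_space K Ks \<mu>)" "measure (table_space K Ks \<mu>) E \<le> \<epsilon>"
    "\<And>Y m. Y \<in> space (table_space K Ks \<mu>) \<Longrightarrow> stops (hist u Y m) \<Longrightarrow>
       \<mu> (leader A u (hist u Y m), 1) < \<mu> (1, 1) \<Longrightarrow> Y \<in> E"
proof -
  interpret T: prob_space "table_space K Ks \<mu>" by (rule prob_space_table)
  have late: "Y \<in> deviation_event m0"
    if "Y \<in> space (table_space K Ks \<mu>)" "stops (hist u Y m)" "\<mu> (leader A u (hist u Y m), 1) < \<mu> (1, 1)"
      "m \<noteq> 1 \<or> m0 \<le> 1" for Y m
  proof (cases "m0 \<le> m")
    case True
    then show ?thesis using wrong_leader_deviation(3)[OF u that(2,3,1)] by simp
  next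
    case False
    then have "2 \<le> m" "m < m0" using wrong_leader_deviation(2)[OF u that(2,3)] that(4) by auto
    with no_stop wrong_leader_deviation(1)[OF u that(2,3)] show ?thesis by fastforce
  qed
  show ?thesis
  proof (cases "m0 \<le> 1 \<or> 1 / 2 \<le> \<beta> 2")
    case True
    show ?thesis
    proof (rule that[OF _ prob])
      fix Y m assume Y: "Y \<in> space (table_space K Ks \<mu>)" "stops (hist u Y m)"
        "\<mu> (leader A u (hist u Y m), 1) < \<mu> (1, 1)"
      have "m \<noteq> 1 \<or> m0 \<le> 1"
        using True wrong_leader_deviation(1)[OF u Y(2,3)] by auto
      then show "Y \<in> deviation_event m0" using late[OF Y] by simp
    qed measurable
  next
    case False
    obtain E where E: "E \<in> sets (table_space K Ks \<mu>)" "measure (table_space K Ks \<mu>) E \<le> 1 / 2"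
      "\<And>Y P Q. Y \<in> space (table_space K Ks \<mu>) \<Longrightarrow> P \<in> drawn u [] \<Longrightarrow> Q \<in> drawn u [] \<Longrightarrow>
        P \<in> arms K Ks \<Longrightarrow> Q \<in> arms K Ks \<Longrightarrow>
        fst P \<noteq> 1 \<Longrightarrow> fst Q = 1 \<Longrightarrow> \<mu> P \<le> \<mu> Q \<Longrightarrow> Y (P, 0) \<Longrightarrow> \<not> Y (Q, 0) \<Longrightarrow> Y \<in> E"
      using first_rounds_event[OF u] by blast
    show ?thesis
    proof (rule that)
      show "deviation_event m0 \<union> E \<in> sets (table_space K Ks \<mu>)" using E(1) by measurable
      have "T.prob (deviation_event m0 \<union> E) \<le> T.prob (deviation_event m0) + T.prob E"
        using E(1) by (intro measure_Un_le) auto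
      then show "T.prob (deviation_event m0 \<union> E) \<le> \<epsilon>" using E(2) first False by auto
      fix Y m assume Y: "Y \<in> space (table_space K Ks \<mu>)" "stops (hist u Y m)"
        "\<mu> (leader A u (hist u Y m), 1) < \<mu> (1, 1)"
      show "Y \<in> deviation_event m0 \<union> E"
      proof (cases "m = 1")
        case True
        then show ?thesis using wrong_leader_deviation(4)[OF u Y(2,3)] E(3)[OF Y(1)] by blast
      next
        case False
        then show ?thesis using late[OF Y] by simp
      qed
    qed
  qed
qed

text \<open>The bound holds on the slice of each seed, where the event may depend on the seed, and
  is then integrated over \<open>R\<close>.\<close>

lemma prob_correct:
  assumes fin: "(\<integral>\<^sup>+\<omega>. ennreal_of_enat (stop_time K Ks \<beta> A \<omega>) \<partial>bandit_space K Ks R \<mu>) < \<infinity>"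
    and no_stop: "\<And>m. 2 \<le> m \<Longrightarrow> m < m0 \<Longrightarrow> real m / 2 \<le> \<beta> (2 * m)"
    and prob: "measure (table_space K Ks \<mu>) (deviation_event m0) \<le> \<epsilon>"
    and first: "m0 \<le> 1 \<or> 1 / 2 \<le> \<beta> 2 \<or> measure (table_space K Ks \<mu>) (deviation_event m0) + 1 / 2 \<le> \<epsilon>"
  shows "measure (bandit_space K Ks R \<mu>)
      {\<omega> \<in> space (bandit_space K Ks R \<mu>). stop_time K Ks \<beta> A \<omega> < \<infinity> \<and>
        \<mu> (1, 1) - \<mu> (recommendation K Ks \<beta> A \<omega>, 1) \<le> 0} \<ge> 1 - \<epsilon>"
proof -
  let ?B = "bandit_space K Ks R \<mu>" and ?T = "table_space K Ks \<mu>"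
  interpret R: prob_space R by (rule R)
  interpret T: prob_space ?T by (rule prob_space_table)
  interpret B: prob_space ?B by (rule prob_space_bandit)
  note [measurable] = measurable_stop_time[OF mlucb] measurable_recommendation[OF mlucb]
  define good where "good \<omega> \<longleftrightarrow> \<mu> (1, 1) - \<mu> (recommendation K Ks \<beta> A \<omega>, 1) \<le> 0" for \<omega>
  have [measurable]: "Measurable.pred ?B good"
    unfolding good_def
    by (rule measurable_compose[OF measurable_recommendation[OF mlucb],
          where g = "\<lambda>i. \<mu> (1, 1) - \<mu> (i, 1) \<le> 0"]) simp
  have [measurable]: "Measurable.pred ?B (\<lambda>\<omega>. stop_time K Ks \<beta> A \<omega> < \<infinity>)"
    by (rule measurable_compose[OF measurable_stop_time[OF mlucb], where g = "\<lambda>t. t < \<infinity>"]) simp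
  define Err where "Err = {\<omega> \<in> space ?B. stop_time K Ks \<beta> A \<omega> < \<infinity> \<and> \<not> good \<omega>}"
  have Err [measurable]: "Err \<in> sets ?B" unfolding Err_def by measurable
  have \<epsilon>: "\<epsilon> \<ge> 0" using prob by (rule order_trans[OF measure_nonneg])
  have "emeasure ?B Err = (\<integral>\<^sup>+u. emeasure ?T (Pair u -` Err) \<partial>R)"
    using Err unfolding bandit_space_def by (rule T.emeasure_pair_measure_alt)
  also have "\<dots> \<le> (\<integral>\<^sup>+u. ennreal \<epsilon> \<partial>R)"
  proof (intro nn_integral_mono)
    fix u assume u: "u \<in> space R"
    obtain E where E: "E \<in> sets ?T" "T.prob E \<le> \<epsilon>"
      "\<And>Y m. Y \<in> space ?T \<Longrightarrow> stops (hist u Y m) \<Longrightarrow>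
         \<mu> (leader A u (hist u Y m), 1) < \<mu> (1, 1) \<Longrightarrow> Y \<in> E"
      using wrong_leader_event[OF u no_stop prob first] by blast
    have "Pair u -` Err \<subseteq> E"
    proof
      fix Y assume "Y \<in> Pair u -` Err"
      then have Y: "Y \<in> space ?T" "stop_time K Ks \<beta> A (u, Y) < \<infinity>" "\<not> good (u, Y)"
        by (auto simp: Err_def bandit_space_def space_pair_measure)
      show "Y \<in> E"
      proof (cases rule: stop_time_cases[of "(u, Y)"])
        case 1
        then show ?thesis using Y(2) by simp
      next
        case (2 M)
        then have "recommendation K Ks \<beta> A (u, Y) = leader A u (hist u Y M)"
          by (simp add: recommendation_def mlucb_history_def)
        then show ?thesis using 2 Y(1,3) by (intro E(3)[of Y M]) (auto simp: good_def)
      qed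
    qed
    then have "emeasure ?T (Pair u -` Err) \<le> emeasure ?T E" by (rule emeasure_mono[OF _ E(1)])
    also have "\<dots> \<le> ennreal \<epsilon>" using E(2) by (simp add: T.emeasure_eq_measure ennreal_leI)
    finally show "emeasure ?T (Pair u -` Err) \<le> ennreal \<epsilon>" .
  qed
  also have "\<dots> = ennreal \<epsilon>" by (simp add: R.emeasure_space_1)
  finally have Err_le: "B.prob Err \<le> \<epsilon>"
    using \<epsilon> by (simp add: B.emeasure_eq_measure)
  \<comment> \<open>The complement of \<open>Err\<close> also contains the runs that never stop;
    finite expected stopping time makes them a null set.\<close>
  have "B.prob (space ?B - Err) = B.prob {\<omega> \<in> space ?B. stop_time K Ks \<beta> A \<omega> < \<infinity> \<and> good \<omega>}"
    using AE_stop_time_finite[OF fin]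
    by (intro B.finite_measure_eq_AE) (measurable, auto simp: Err_def)
  then show ?thesis
    using B.prob_compl[OF Err] Err_le unfolding good_def by simp
qed

end

subsection \<open>The two guarantees\<close>

lemma mlucb_pac:
  assumes \<alpha>: "\<alpha> > 1" and C: "C > 0"
    and series: "exp 1 * real (\<Sum>i=1..K. Ks i) *
      (\<Sum>n. ln (real (Suc n)) * ln (C * real (Suc n) powr (1 + \<alpha>)) / real (Suc n) powr (1 + \<alpha>)) \<le> C"
    and D: "C * 2 powr (1 + \<alpha>) \<ge> 1"
    and \<delta>: "0 < \<delta>" "\<delta> < 1"
    and run: "mlucb_run K Ks \<mu> (expl_rate C \<alpha> \<delta>) R A"
    and fin: "(\<integral>\<^sup>+\<omega>. ennreal_of_enat (stop_time K Ks (expl_rate C \<alpha> \<delta>) A \<omega>) \<partial>bandit_space K Ks R \<mu>) < \<infinity>"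
  shows "measure (bandit_space K Ks R \<mu>)
      {\<omega> \<in> space (bandit_space K Ks R \<mu>). stop_time K Ks (expl_rate C \<alpha> \<delta>) A \<omega> < \<infinity> \<and>
        \<mu> (1, 1) - \<mu> (recommendation K Ks (expl_rate C \<alpha> \<delta>) A \<omega>, 1) \<le> 0} \<ge> 1 - \<delta>"
proof -
  interpret mlucb_run K Ks \<mu> "expl_rate C \<alpha> \<delta>" R A by (rule run)
  define s where "s = 1 + \<alpha>"
  define D where "D = C * 2 powr s"
  define N where "N = real (card (arms K Ks))"
  have D1: "D \<ge> 1" using D by (simp add: D_def s_def)
  have "2 \<le> (\<Sum>i=1..K. 1 :: nat)" using K by simp
  also have "\<dots> \<le> (\<Sum>i=1..K. Ks i)" using Ks by (intro sum_mono) auto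
  finally have N: "N \<ge> 2" by (simp only: N_def card_arms numeral_le_real_of_nat_iff)
  have rate: "expl_rate C \<alpha> \<delta> (2 * m) = ln D + s * ln (real m) + ln (1 / \<delta>)" if "m > 0" for m
    using that C \<delta> by (simp add: expl_rate_eq D_def s_def ln_mult ln_powr algebra_simps)
  have exp_rate: "exp (- expl_rate C \<alpha> \<delta> (2 * m)) = \<delta> / D * (1 / real m powr s)" if "m > 0" for m
    using that C \<delta> by (simp add: exp_minus_expl_rate D_def s_def powr_mult)
  have "5 / 3 * N \<le> D \<or> s \<ge> 4 \<and> N \<le> (3 / 2) powr s"
    unfolding D_def using series D N \<alpha> C
    by (intro rate_constant_cases) (simp_all add: s_def N_def card_arms)
  then show ?thesis
  proof
    \<comment> \<open>No time needs to be excluded. As s > 2, n^s may be replaced by n^2, and the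
      union bound is N (\<delta> / D) (5/3) \<le> \<delta>.\<close>
    assume large: "5 / 3 * N \<le> D"
    have le: "exp (- expl_rate C \<alpha> \<delta> (2 * max (Suc k) 1)) \<le> \<delta> / D * (1 / (real (Suc k))\<^sup>2)" for k
    proof -
      have "(real (Suc k))\<^sup>2 \<le> real (Suc k) powr s"
        using \<alpha> powr_mono[of 2 s "real (Suc k)"] by (simp add: s_def powr_numeral)
      then have "1 / real (Suc k) powr s \<le> 1 / (real (Suc k))\<^sup>2"
        by (intro divide_left_mono) (auto simp del: of_nat_Suc)
      then have "\<delta> / D * (1 / real (Suc k) powr s) \<le> \<delta> / D * (1 / (real (Suc k))\<^sup>2)"
        using \<delta> D1 by (intro mult_left_mono) auto
      then show ?thesis using exp_rate[of "Suc k"] by simp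
    qed
    have "measure (table_space K Ks \<mu>) (deviation_event 1)
        \<le> card (arms K Ks) * (\<Sum>k. \<delta> / D * (1 / (real (Suc k))\<^sup>2))"
      by (rule prob_deviation_event[OF summable_mult[OF sums_inverse_squares_le(1)] le])
    also have "\<dots> = N * (\<delta> / D) * (\<Sum>k. 1 / (real (Suc k))\<^sup>2)"
      by (subst suminf_mult[OF sums_inverse_squares_le(1)]) (simp add: N_def)
    also have "\<dots> \<le> N * (\<delta> / D) * (5 / 3)"
      using \<delta> D1 N by (intro mult_left_mono sums_inverse_squares_le(2)) auto
    also have "\<dots> = \<delta> * ((5 / 3 * N) / D)" by (simp add: mult_ac)
    also have "\<dots> \<le> \<delta> * 1" using large \<delta> D1 by (intro mult_left_mono) auto
    finally show ?thesis
      by (intro prob_correct[OF fin, of 1]) auto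
  next
    assume small: "s \<ge> 4 \<and> N \<le> (3 / 2) powr s"
    have ln_pow: "4 * (real k * (2 / 3)) \<le> expl_rate C \<alpha> \<delta> (2 * m)" if "2 ^ k \<le> m" for k m :: nat
    proof -
      have m: "m > 0" using that by (intro Nat.gr0I) auto
      have "real k * (2 / 3) \<le> real k * ln 2" using ln2_ge_two_thirds by (intro mult_left_mono) auto
      also have "\<dots> = ln (2 ^ k)" by (simp add: ln_realpow)
      also have "\<dots> \<le> ln (real m)"
      proof -
        have "real (2 ^ k) \<le> real m" using that by (simp only: of_nat_le_iff)
        then show ?thesis using m by simp
      qed
      finally have "4 * (real k * (2 / 3)) \<le> s * ln (real m)"
        using small m by (intro mult_mono) auto
      moreover have "ln D \<ge> 0" "ln (1 / \<delta>) \<ge> 0" using D1 \<delta> by auto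
      ultimately show ?thesis using rate[OF m] by linarith
    qed
    \<comment> \<open>Dyadic blocks: for 2^k \<le> m < 2^(k+1) the rate is at least 8 k / 3. This is
      8/3, 16/3 and 8, while m / 2 is at most 3/2, 7/2 and 15/2.\<close>
    have no_stop: "real m / 2 \<le> expl_rate C \<alpha> \<delta> (2 * m)" if "2 \<le> m" "m < 16" for m
    proof -
      consider "m < 4" | "4 \<le> m" "m < 8" | "8 \<le> m" by linarith
      then show ?thesis
      proof cases
        case 1 then show ?thesis using ln_pow[of 1 m] that by simp
      next
        case 2 then show ?thesis using ln_pow[of 2 m] that by simp
      next
        case 3 then show ?thesis using ln_pow[of 3 m] that by simp
      qed
    qed
    \<comment> \<open>For m = max n 16 one has m^s \<ge> 16^(s-2) n^2: the first factor supplies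
      smallness, the second summability.\<close>
    define c where "c = \<delta> / 16 powr (s - 2)"
    have le: "exp (- expl_rate C \<alpha> \<delta> (2 * max (Suc k) 16)) \<le> c * (1 / (real (Suc k))\<^sup>2)" for k
    proof -
      define m where "m = max (Suc k) 16"
      have m: "real m \<ge> 16" "real m \<ge> real (Suc k)" by (auto simp: m_def)
      have "16 powr (s - 2) * (real (Suc k))\<^sup>2 \<le> real m powr (s - 2) * (real m)\<^sup>2"
        using m small by (intro mult_mono powr_mono2 power_mono) auto
      also have "\<dots> = real m powr s" using m by (simp add: powr_diff powr_numeral)
      finally have recip: "1 / real m powr s \<le> 1 / (16 powr (s - 2) * (real (Suc k))\<^sup>2)"
        by (intro divide_left_mono) (use m in \<open>auto simp del: of_nat_Suc\<close>)
      have "\<delta> / D \<le> \<delta> / 1" using \<delta> D1 by (intro divide_left_mono) auto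
      then have "\<delta> / D * (1 / real m powr s) \<le> \<delta> / 1 * (1 / (16 powr (s - 2) * (real (Suc k))\<^sup>2))"
        by (rule mult_mono[OF _ recip]) (use \<delta> in auto)
      moreover have "m > 0" by (simp add: m_def)
      ultimately show ?thesis unfolding m_def[symmetric] using exp_rate[of m] by (simp add: c_def)
    qed
    have "measure (table_space K Ks \<mu>) (deviation_event 16)
        \<le> card (arms K Ks) * (\<Sum>k. c * (1 / (real (Suc k))\<^sup>2))"
      by (rule prob_deviation_event[OF summable_mult[OF sums_inverse_squares_le(1)] le])
    also have "\<dots> = N * c * (\<Sum>k. 1 / (real (Suc k))\<^sup>2)"
      by (subst suminf_mult[OF sums_inverse_squares_le(1)]) (simp add: N_def)
    also have "\<dots> \<le> N * c * (5 / 3)"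
      using \<delta> N by (intro mult_left_mono sums_inverse_squares_le(2)) (auto simp: c_def)
    also have "\<dots> = \<delta> * (N * (1 / 16 powr (s - 2)) * (5 / 3))" by (simp add: c_def)
    also have "\<dots> \<le> \<delta> * (1 / 10)"
      using small N \<delta> by (intro mult_left_mono inverse_powr_tail_le) auto
    finally have dev: "measure (table_space K Ks \<mu>) (deviation_event 16) \<le> \<delta> / 10" by simp
    \<comment> \<open>The threshold 5/9 solves \<delta> / 10 + 1/2 = \<delta>. Below it, ln
      (1/\<delta>) \<ge> ln (9/5) \<ge> 1/2 because (9/5)^2 > 3 \<ge> e.\<close>
    have "1 / 2 \<le> expl_rate C \<alpha> \<delta> 2 \<or> 5 / 9 \<le> \<delta>"
    proof (rule disjCI)
      assume "\<not> 5 / 9 \<le> \<delta>"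
      have "1 = ln (exp 1 :: real)" by simp
      also have "\<dots> \<le> ln ((9 / 5)\<^sup>2)"
        using exp_le by (subst ln_le_cancel_iff) (auto simp: power2_eq_square)
      also have "\<dots> = 2 * ln (9 / 5)" by (simp add: ln_realpow)
      also have "ln (9 / 5) \<le> ln (1 / \<delta>)"
        using \<delta> \<open>\<not> 5 / 9 \<le> \<delta>\<close> by (subst ln_le_cancel_iff) (auto simp: field_simps)
      finally have "1 / 2 \<le> ln (1 / \<delta>)" by simp
      moreover have "ln D \<ge> 0" using D1 by simp
      ultimately show "1 / 2 \<le> expl_rate C \<alpha> \<delta> 2" using rate[of 1] by simp
    qed
    then show ?thesis using dev \<delta>
      by (intro prob_correct[OF fin no_stop, of 16]) auto
  qed
qed

text \<open>With \<open>x = x0 + e / 2\<close>, the constant \<open>c\<close> is below (e / 2) ln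
  (1/\<delta>) once \<delta> is small, so the ratio is eventually at most
  \<open>x0 + e\<close>.\<close>

lemma Limsup_ratio_le:
  fixes f :: "real \<Rightarrow> ennreal"
  assumes x0: "0 \<le> x0"
    and bound: "\<And>x. x > x0 \<Longrightarrow> \<exists>c\<ge>0. \<forall>\<delta>. 0 < \<delta> \<and> \<delta> < 1 \<longrightarrow> f \<delta> \<le> ennreal (x * ln (1 / \<delta>) + c)"
  shows "Limsup (at_right 0) (\<lambda>\<delta>. f \<delta> / ennreal (ln (1 / \<delta>))) \<le> ennreal x0"
proof (rule ennreal_le_epsilon)
  fix e :: real assume e: "e > 0"
  define x where "x = x0 + e / 2"
  obtain c where c: "c \<ge> 0" "\<And>\<delta>. 0 < \<delta> \<Longrightarrow> \<delta> < 1 \<Longrightarrow> f \<delta> \<le> ennreal (x * ln (1 / \<delta>) + c)"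
    using bound[of x] e by (auto simp: x_def)
  have "filterlim (\<lambda>\<delta> :: real. ln (1 / \<delta>)) at_top (at_right 0)" by real_asymp
  then have "\<forall>\<^sub>F \<delta> in at_right 0. ln (1 / \<delta>) \<ge> 2 * c / e" by (rule filterlim_at_top[THEN iffD1, rule_format])
  moreover have "\<forall>\<^sub>F \<delta> in at_right (0 :: real). 0 < \<delta> \<and> \<delta> < 1"
    by (auto simp: eventually_at_right_field intro!: exI[of _ 1])
  ultimately have "\<forall>\<^sub>F \<delta> in at_right 0. f \<delta> / ennreal (ln (1 / \<delta>)) \<le> ennreal (x0 + e)"
  proof eventually_elim
    case (elim \<delta>)
    have l: "ln (1 / \<delta>) > 0" using elim by simp
    have "f \<delta> / ennreal (ln (1 / \<delta>)) \<le> ennreal (x * ln (1 / \<delta>) + c) / ennreal (ln (1 / \<delta>))"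
      using c(2) elim by (intro divide_right_mono_ennreal) auto
    also have "\<dots> = ennreal ((x * ln (1 / \<delta>) + c) / ln (1 / \<delta>))"
      using l c(1) x0 e by (intro divide_ennreal) (auto simp: x_def)
    also have "\<dots> \<le> ennreal (x0 + e)"
    proof (intro ennreal_leI)
      have "c \<le> e / 2 * ln (1 / \<delta>)" using elim(1) e by (simp add: field_simps)
      then show "(x * ln (1 / \<delta>) + c) / ln (1 / \<delta>) \<le> x0 + e"
        using l by (simp add: x_def pos_divide_le_eq algebra_simps)
    qed
    finally show ?case .
  qed
  then have "Limsup (at_right 0) (\<lambda>\<delta>. f \<delta> / ennreal (ln (1 / \<delta>))) \<le> ennreal (x0 + e)"
    by (rule Limsup_bounded)
  then show "Limsup (at_right 0) (\<lambda>\<delta>. f \<delta> / ennreal (ln (1 / \<delta>))) \<le> ennreal x0 + ennreal e"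
    using x0 e by (simp add: ennreal_plus)
qed

text \<open>The rate at time 2 is nonnegative for every confidence level below 1; letting the level
  tend to 1 gives the claim.\<close>

lemma one_le_rate_constant:
  assumes "C > 0" "\<And>\<delta>. 0 < \<delta> \<Longrightarrow> \<delta> < 1 \<Longrightarrow> 0 \<le> expl_rate C \<alpha> \<delta> 2"
  shows "C * 2 powr (1 + \<alpha>) \<ge> 1"
proof (rule field_le_mult_one_interval)
  fix z :: real assume z: "0 < z" "z < 1"
  have "ln 1 \<le> ln (C * 2 powr (1 + \<alpha>) / z)"
    using assms(2)[OF z] by (simp add: expl_rate_def)
  then have "1 \<le> C * 2 powr (1 + \<alpha>) / z"
    using assms(1) z by (subst (asm) ln_le_cancel_iff) auto
  then show "z * 1 \<le> C * 2 powr (1 + \<alpha>)" using z by (simp add: field_simps)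
qed

theorem theorem4:
  fixes K :: nat and Ks :: "nat \<Rightarrow> nat" and \<alpha> C :: real
    and R :: "'s measure" and A :: "real \<Rightarrow> 's mlucb_choice"
  assumes "K \<ge> 2"
    and "\<And>i. i \<in> {1..K} \<Longrightarrow> Ks i \<ge> 1"
    and "\<alpha> > 1"
    and "C > 0"
    and "exp 1 * real (\<Sum>i=1..K. Ks i) *
           (\<Sum>n. ln (real (Suc n)) * ln (C * real (Suc n) powr (1 + \<alpha>)) / real (Suc n) powr (1 + \<alpha>)) \<le> C"
    and "\<And>\<delta> t. 0 < \<delta> \<Longrightarrow> \<delta> < 1 \<Longrightarrow> even t \<Longrightarrow> t > 0 \<Longrightarrow> 0 \<le> expl_rate C \<alpha> \<delta> t"
    and "prob_space R"
    and "\<And>\<delta>. 0 < \<delta> \<Longrightarrow> \<delta> < 1 \<Longrightarrow> is_mlucb K Ks (expl_rate C \<alpha> \<delta>) R (A \<delta>)"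
  shows "(\<forall>\<delta> \<mu>. 0 < \<delta> \<and> \<delta> < 1 \<and> bandit_instance K Ks \<mu> \<and> \<mu> (1, 1) > \<mu> (2, 1) \<longrightarrow>
            measure (bandit_space K Ks R \<mu>)
              {\<omega> \<in> space (bandit_space K Ks R \<mu>).
                 stop_time K Ks (expl_rate C \<alpha> \<delta>) (A \<delta>) \<omega> < \<infinity> \<and>
                 \<mu> (1, 1) - \<mu> (recommendation K Ks (expl_rate C \<alpha> \<delta>) (A \<delta>) \<omega>, 1) \<le> 0}
            \<ge> 1 - \<delta>) \<and>
         (\<forall>\<mu>. bandit_instance K Ks \<mu> \<and> \<mu> (1, 1) > \<mu> (2, 1) \<longrightarrow>
            Limsup (at_right 0)
              (\<lambda>\<delta>. (\<integral>\<^sup>+ \<omega>. ennreal_of_enat (stop_time K Ks (expl_rate C \<alpha> \<delta>) (A \<delta>) \<omega>)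
                        \<partial>bandit_space K Ks R \<mu>) / ennreal (ln (1 / \<delta>)))
            \<le> ennreal (4 * H_star K Ks \<mu>))"
proof (intro conjI allI impI)
  fix \<delta> :: real and \<mu> :: "arm \<Rightarrow> real" assume *: "0 < \<delta> \<and> \<delta> < 1 \<and> bandit_instance K Ks \<mu> \<and> \<mu> (1, 1) > \<mu> (2, 1)"
  then have \<delta>: "0 < \<delta>" "\<delta> < 1" by auto
  have run: "mlucb_run K Ks \<mu> (expl_rate C \<alpha> \<delta>) R (A \<delta>)"
    using * assms by (intro mlucb_run_expl_rate) auto
  \<comment> \<open>Any number above \<open>4 * H_star K Ks \<mu>\<close> serves here; only
    finiteness of the expectation matters for correctness.\<close>
  obtain c where "(\<integral>\<^sup>+\<omega>. ennreal_of_enat (stop_time K Ks (expl_rate C \<alpha> \<delta>) (A \<delta>) \<omega>)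
      \<partial>bandit_space K Ks R \<mu>) \<le> ennreal ((4 * H_star K Ks \<mu> + 1) * ln (1 / \<delta>) + c)"
    using mlucb_expected_stop_time[OF assms(1-4,6-8), of \<mu> "4 * H_star K Ks \<mu> + 1"] * by auto
  then have "(\<integral>\<^sup>+\<omega>. ennreal_of_enat (stop_time K Ks (expl_rate C \<alpha> \<delta>) (A \<delta>) \<omega>)
      \<partial>bandit_space K Ks R \<mu>) < \<infinity>"
    by (rule le_less_trans) simp
  then show "measure (bandit_space K Ks R \<mu>)
      {\<omega> \<in> space (bandit_space K Ks R \<mu>).
         stop_time K Ks (expl_rate C \<alpha> \<delta>) (A \<delta>) \<omega> < \<infinity> \<and>
         \<mu> (1, 1) - \<mu> (recommendation K Ks (expl_rate C \<alpha> \<delta>) (A \<delta>) \<omega>, 1) \<le> 0}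
    \<ge> 1 - \<delta>"
    using assms(6)[of _ 2] by (intro mlucb_pac[OF assms(3-5) one_le_rate_constant \<delta> run] assms(4)) auto
next
  fix \<mu> :: "arm \<Rightarrow> real" assume *: "bandit_instance K Ks \<mu> \<and> \<mu> (1, 1) > \<mu> (2, 1)"
  have "H_star K Ks \<mu> \<ge> 0"
    unfolding H_star_def by (auto intro!: sum_nonneg simp: le_max_iff_disj)
  then show "Limsup (at_right 0)
      (\<lambda>\<delta>. (\<integral>\<^sup>+\<omega>. ennreal_of_enat (stop_time K Ks (expl_rate C \<alpha> \<delta>) (A \<delta>) \<omega>)
          \<partial>bandit_space K Ks R \<mu>) / ennreal (ln (1 / \<delta>))) \<le> ennreal (4 * H_star K Ks \<mu>)"
    using mlucb_expected_stop_time[OF assms(1-4,6-8)] * by (intro Limsup_ratio_le) auto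
qed

end
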